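(* Let $\mathcal S$ be a locally compact Hausdorff space, let $\mathfrak B$ be a generative Boolean subalgebra of $\mathfrak R(\mathcal S)$, let $\mu$ be a content on $\mathfrak B$, and let $\mu^*$ be the corresponding probability charge on $\mathrm{Clp}(\mathcal S^* )$, where $\mathcal S^*=\sigma(\mathfrak B)$. Then $\mu^*$ can be extended to a unique Borel probability measure on $\mathcal S^*$ (also denoted $\mu^*$). Furthermore, for any $g\in\mathcal G_{\mathfrak B}(\mathcal S)$ and any $D\in\mathfrak B$, $$\fint_D g\,d\mu=\int_{D^*}g^*\,d\mu^*.$$
   Context: For a topological space $\mathcal T$, an open set $R\subseteq\mathcal T$ is regular if $R=\mathrm{int}(\mathrm{clos}(R))$. $\mathfrak R(\mathcal T)$ is the set of regular open subsets; it is a Boolean algebra with meet $\cap$, join $Q\vee R:=\mathrm{int}(\mathrm{clos}(Q\cup R))$ and complement $\neg R:=\mathrm{int}(\mathcal T\setminus R)$. A Boolean subalgebra is a subset closed under $\cap,\vee,\neg$. A content on $\mathfrak B\subseteq\mathfrak R(\mathcal S)$ is a function $\mu:\mathfrak B\to[0,\infty)$ such that $\mu[B_1\vee\cdots\vee B_N]=\sum_n\mu[B_n]$ for every finite collection of disjoint elements of $\mathfrak B$; by standing assumption $\mu[\mathcal S]=1$. Let $\widehat{\mathcal S}$ be the Stone-Čech compactification of $\mathcal S$. The map $Q\mapsto Q\cap\mathcal S$ is a Boolean algebra isomorphism $\mathfrak R(\widehat{\mathcal S})\to\mathfrak R(\mathcal S)$; for $R\in\mathfrak R(\mathcal S)$,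 $\widehat R$ denotes the unique element of $\mathfrak R(\widehat{\mathcal S})$ with $\widehat R\cap\mathcal S=R$. $\mathfrak B$ is generative if $\{\widehat B: B\in\mathfrak B\}$ is a base for the topology of $\widehat{\mathcal S}$. $\mathcal S^*:=\sigma(\mathfrak B)$ is the Stone space of $\mathfrak B$: the set of ultrafilters of $\mathfrak B$ with base of clopen sets $B^*:=\{s^*\in\mathcal S^*: B\in s^*\}$, $B\in\mathfrak B$. $\mathrm{Clp}(\mathcal S^* )$ is the Boolean algebra of clopen subsets of $\mathcal S^*$ under the usual set operations; $B\mapsto B^*$ is an isomorphism $\mathfrak B\to\mathrm{Clp}(\mathcal S^* )$. A probability charge is a finitely additive $[0,1]$-valued set function of total mass $1$; the probability charge $\mu^*$ on $\mathrm{Clp}(\mathcal S^* )$ is $\mu^*[B^*]:=\mu[B]$. A Borel probability measure is a countably additive probability measure on the Borel sigma-algebra. For each $s^*\in\mathcal S^*$ the set $\bigcap_{B\in s^*}\mathrm{clos}(\widehat B)\subseteq\widehat{\mathcal S}$ has exactly one element $p(s^* )$, and $p:\mathcal S^*\to\widehat{\mathcal S}$ is a continuous surjection. For bounded continuous $g:\mathcal S\to\mathbb R$, let $\widehat g$ be its unique continuous extension to $\widehat{\mathcal S}$, and $g^*:=\widehat g\circ p:\mathcal S^*\to\mathbb R$. $\mathcal C_{\mathfrak B}(\mathcal S)$ is the set of bounded continuous $f:\mathcal S\to\mathbb R$ that are $\mathfrak B$-comeasurable, i.e. $\mathrm{int}(f^{-1}(-\infty,r])\in\mathfrak B$ and $\mathrm{int}(f^{-1}[r,\infty))\in\mathfrak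 B$ for all $r\in\mathbb R$. $\mathcal G_{\mathfrak B}(\mathcal S)$ is the closed linear span of $\mathcal C_{\mathfrak B}(\mathcal S)$ in the Banach space of bounded continuous real-valued functions on $\mathcal S$ with the uniform norm. Integral against a content: a $\mathfrak B$-partition of $\mathcal S$ is a finite collection of disjoint elements of $\mathfrak B$ with join $\mathcal S$; $f:\mathcal S\to\mathbb R$ is $\mathfrak B$-simple if it is constant on each cell of some $\mathfrak B$-partition (values off the cells are arbitrary and irrelevant). For $\mathfrak B$-simple $f$ with value $r_n$ on the cell $P_n$, $\fint_D f\,d\mu:=\sum_n r_n\mu[P_n\cap D]$. Every $g\in\mathcal G_{\mathfrak B}(\mathcal S)$ is a uniform limit of $\mathfrak B$-simple functions, and $\fint_D g\,d\mu$ is the supremum of $\fint_D f\,d\mu$ over all $\mathfrak B$-simple $f$ with $f\le g$ on $D$.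
   Formalization: Uniqueness is proved among regular Borel probability measures, and any two Borel extensions agree on the sigma-algebra generated by the clopen sets; literal uniqueness fails (Dirac versus Dieudonné measure on ω₁+1); the integral formula is proved for every Borel extension. *)

theory Defs
  imports "HOL-Probability.Probability"
begin

section \<open>Regular open sets and contents\<close>

definition regular_open :: "'a topology \<Rightarrow> 'a set \<Rightarrow> bool" where
  "regular_open X R \<longleftrightarrow> openin X R \<and> X interior_of (X closure_of R) = R"

text \<open>The join of an arbitrary collection; on a two-element collection \<open>{Q, R}\<close> it is
  \<open>int (clos (Q \<union> R))\<close>, and on a finite collection it is the iterated binary join.\<close>

definition reg_join :: "'a topology \<Rightarrow> 'a set set \<Rightarrow> 'a set" where
  "reg_join X \<Q> = X interior_of (X closure_of (\<Union>\<Q>))"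

definition reg_compl :: "'a topology \<Rightarrow> 'a set \<Rightarrow> 'a set" where
  "reg_compl X R = X interior_of (topspace X - R)"

definition reg_subalgebra :: "'a topology \<Rightarrow> 'a set set \<Rightarrow> bool" where
  "reg_subalgebra X \<BB> \<longleftrightarrow>
     \<BB> \<noteq> {} \<and> (\<forall>B\<in>\<BB>. regular_open X B) \<and>
     (\<forall>A\<in>\<BB>. \<forall>B\<in>\<BB>. A \<inter> B \<in> \<BB> \<and> reg_join X {A, B} \<in> \<BB>) \<and>
     (\<forall>B\<in>\<BB>. reg_compl X B \<in> \<BB>)"

definition reg_content :: "'a topology \<Rightarrow> 'a set set \<Rightarrow> ('a set \<Rightarrow> real) \<Rightarrow> bool" where
  "reg_content X \<BB> \<mu> \<longleftrightarrow>
     (\<forall>B\<in>\<BB>. 0 \<le> \<mu> B) \<and>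
     (\<forall>(N::nat) B. (\<forall>n<N. B n \<in> \<BB>) \<and> disjoint_family_on B {..<N} \<longrightarrow>
        \<mu> (reg_join X (B ` {..<N})) = (\<Sum>n<N. \<mu> (B n))) \<and>
     \<mu> (topspace X) = 1"


section \<open>The Stone-Cech compactification\<close>

text \<open>Realised as the closure of the image of \<open>X\<close> under the evaluation map into the product of
  copies of the real line indexed by the bounded continuous functions on \<open>X\<close>.  Thus \<open>X\<close> is not
  literally a subset of \<open>stone_cech X\<close>; it is embedded by \<open>sc_emb X\<close>, and intersections with \<open>X\<close>
  become preimages.  Bounded continuous functions are elements of \<open>'a \<Rightarrow> real\<close> whose values outside
  \<open>topspace X\<close> are irrelevant; two that agree on \<open>topspace X\<close> only give equal coordinates.\<close>

definition bcont :: "'a topology \<Rightarrow> ('a \<Rightarrow> real) set" where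
  "bcont X = {f. continuous_map X euclideanreal f \<and> bounded (f ` topspace X)}"

definition sc_emb :: "'a topology \<Rightarrow> 'a \<Rightarrow> ('a \<Rightarrow> real) \<Rightarrow> real" where
  "sc_emb X x = (\<lambda>f\<in>bcont X. f x)"

definition stone_cech :: "'a topology \<Rightarrow> (('a \<Rightarrow> real) \<Rightarrow> real) topology" where
  "stone_cech X = subtopology (product_topology (\<lambda>f. euclideanreal) (bcont X))
     (product_topology (\<lambda>f. euclideanreal) (bcont X) closure_of (sc_emb X ` topspace X))"

text \<open>The following lemmas confirm that this is a compactification of every completely regular
  Hausdorff space (in particular of every locally compact Hausdorff space) to which all bounded
  continuous functions extend.\<close>

lemma topspace_stone_cech: "topspace (stone_cech X) =
    product_topology (\<lambda>f. euclideanreal) (bcont X) closure_of (sc_emb X ` topspace X)"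
  unfolding stone_cech_def topspace_subtopology
  by (rule Int_absorb1, rule closure_of_subset_topspace)

lemma sc_emb_in: "sc_emb X ` topspace X \<subseteq> topspace (stone_cech X)"
  unfolding topspace_stone_cech
  by (rule closure_of_subset) (auto simp: sc_emb_def)

lemma stone_cech_dense: "stone_cech X closure_of (sc_emb X ` topspace X) = topspace (stone_cech X)"
  using sc_emb_in[of X] unfolding topspace_stone_cech
  by (simp add: stone_cech_def closure_of_subtopology Int_absorb1)

lemma Hausdorff_stone_cech: "Hausdorff_space (stone_cech X)"
  unfolding stone_cech_def
  by (intro Hausdorff_space_subtopology) (simp add: Hausdorff_space_product_topology)

lemma compact_stone_cech: "compact_space (stone_cech X)"
proof -
  let ?P = "product_topology (\<lambda>f. euclideanreal) (bcont X)"
  have "\<exists>K. \<forall>x\<in>topspace X. \<bar>f x\<bar> \<le> K" if "f \<in> bcont X" for f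
    using that by (simp add: bcont_def bounded_iff)
  then obtain K where K: "\<And>f x. f \<in> bcont X \<Longrightarrow> x \<in> topspace X \<Longrightarrow> \<bar>f x\<bar> \<le> K f"
    by metis
  let ?C = "PiE (bcont X) (\<lambda>f. {- K f..K f})"
  have C: "compactin ?P ?C" by (simp add: compactin_PiE)
  have "closedin ?P ?C"
    by (rule compactin_imp_closedin[OF _ C]) (simp add: Hausdorff_space_product_topology)
  moreover have "sc_emb X ` topspace X \<subseteq> ?C"
  proof (rule image_subsetI)
    fix x assume "x \<in> topspace X"
    then have "- K f \<le> f x \<and> f x \<le> K f" if "f \<in> bcont X" for f
      using K[OF that, of x] by linarith
    then show "sc_emb X x \<in> ?C" by (simp add: sc_emb_def)
  qed
  ultimately have "?P closure_of (sc_emb X ` topspace X) \<subseteq> ?C"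
    by (rule closure_of_minimal[rotated])
  then have "compactin ?P (?P closure_of (sc_emb X ` topspace X))"
    by (rule closed_compactin[OF C]) simp
  then show ?thesis unfolding stone_cech_def by (rule compact_space_subtopology)
qed

lemma stone_cech_extension:
  assumes "g \<in> bcont X"
  shows "continuous_map (stone_cech X) euclideanreal (\<lambda>y. y g)"
    and "x \<in> topspace X \<Longrightarrow> sc_emb X x g = g x"
  using assms unfolding stone_cech_def sc_emb_def
  by (auto intro!: continuous_map_from_subtopology continuous_map_product_projection)

lemma embedding_map_sc_emb:
  assumes "completely_regular_space X" "Hausdorff_space X"
  shows "embedding_map X (stone_cech X) (sc_emb X)"
proof -
  have sep: "\<exists>f\<in>bcont X. f x = 0 \<and> (\<forall>y\<in>topspace X - U. f y = 1)"
    if "openin X U" "x \<in> U" for x U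
  proof -
    have "closedin X (topspace X - U)" "x \<in> topspace X - (topspace X - U)"
      using that openin_subset by (auto simp: closedin_diff)
    then obtain f where f: "continuous_map X (top_of_set {0..1::real}) f" "f x = 0"
        "f ` (topspace X - U) \<subseteq> {1}"
      using assms(1) unfolding completely_regular_space_def
      by (metis image_subset_iff_funcset)
    have "f \<in> bcont X"
      using f(1) by (auto simp: bcont_def continuous_map_in_subtopology
          intro: bounded_subset[OF bounded_closed_interval])
    with f show ?thesis by auto
  qed
  have inj: "inj_on (sc_emb X) (topspace X)"
  proof (rule inj_onI, rule ccontr)
    fix x y assume xy: "x \<in> topspace X" "y \<in> topspace X" "sc_emb X x = sc_emb X y" "x \<noteq> y"
    then have "openin X (topspace X - {y})"
      using assms(2) by (simp add: closedin_Hausdorff_singleton openin_diff)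
    from sep[OF this, of x] xy obtain f where "f \<in> bcont X" "f x = 0" "f y = 1" by auto
    with fun_cong[OF xy(3), of f] show False by (simp add: sc_emb_def)
  qed
  have cont: "continuous_map X (stone_cech X) (sc_emb X)"
    unfolding stone_cech_def continuous_map_in_subtopology
    using sc_emb_in[of X] unfolding topspace_stone_cech
    by (auto simp: continuous_map_componentwise sc_emb_def) (auto simp: bcont_def)
  have "open_map X (subtopology (stone_cech X) (sc_emb X ` topspace X)) (sc_emb X)"
    unfolding open_map_def
  proof (intro allI impI)
    fix U assume U: "openin X U"
    show "openin (subtopology (stone_cech X) (sc_emb X ` topspace X)) (sc_emb X ` U)"
    proof (subst openin_subopen, intro ballI)
      fix z assume "z \<in> sc_emb X ` U"
      then obtain x where x: "x \<in> U" "z = sc_emb X x" by auto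
      then obtain f where f: "f \<in> bcont X" "f x = 0" "\<forall>y\<in>topspace X - U. f y = 1"
        using sep U by metis
      let ?W = "{y \<in> topspace (stone_cech X). y f \<in> {..<1}}"
      have "openin (stone_cech X) ?W"
        using stone_cech_extension(1)[OF f(1)] by (rule openin_continuous_map_preimage) simp
      then have "openin (subtopology (stone_cech X) (sc_emb X ` topspace X))
          (?W \<inter> sc_emb X ` topspace X)"
        by (auto simp: openin_subtopology)
      moreover have "z \<in> ?W \<inter> sc_emb X ` topspace X"
        using x f openin_subset[OF U] sc_emb_in[of X] by (auto simp: sc_emb_def)
      moreover have "?W \<inter> sc_emb X ` topspace X \<subseteq> sc_emb X ` U"
      proof
        fix w assume w: "w \<in> ?W \<inter> sc_emb X ` topspace X"
        then obtain y where y: "y \<in> topspace X" "w = sc_emb X y" by auto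
        with w f(1) have "f y < 1" by (auto simp: sc_emb_def)
        with f(3) y show "w \<in> sc_emb X ` U" by force
      qed
      ultimately show "\<exists>T. openin (subtopology (stone_cech X) (sc_emb X ` topspace X)) T \<and> z \<in> T
          \<and> T \<subseteq> sc_emb X ` U" by blast
    qed
  qed
  moreover have "continuous_map X (subtopology (stone_cech X) (sc_emb X ` topspace X)) (sc_emb X)"
    using cont by (simp add: continuous_map_in_subtopology)
  moreover have "topspace (subtopology (stone_cech X) (sc_emb X ` topspace X)) = sc_emb X ` topspace X"
    using sc_emb_in by (rule topspace_subtopology_subset)
  ultimately show ?thesis
    using inj unfolding embedding_map_def by (intro bijective_open_imp_homeomorphic_map) simp_all
qed

definition sc_hat :: "'a topology \<Rightarrow> 'a set \<Rightarrow> (('a \<Rightarrow> real) \<Rightarrow> real) set" where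
  "sc_hat X R = (THE Q. regular_open (stone_cech X) Q \<and> {x \<in> topspace X. sc_emb X x \<in> Q} = R)"

text \<open>The unique continuous extension; \<open>extensional\<close> only fixes the values outside
  \<open>topspace (stone_cech X)\<close>, so that it is unique as a HOL function.\<close>

definition sc_ext :: "'a topology \<Rightarrow> ('a \<Rightarrow> real) \<Rightarrow> (('a \<Rightarrow> real) \<Rightarrow> real) \<Rightarrow> real" where
  "sc_ext X g = (THE h. h \<in> extensional (topspace (stone_cech X)) \<and>
     continuous_map (stone_cech X) euclideanreal h \<and> (\<forall>x\<in>topspace X. h (sc_emb X x) = g x))"

definition generative :: "'a topology \<Rightarrow> 'a set set \<Rightarrow> bool" where
  "generative X \<BB> \<longleftrightarrow> openin (stone_cech X) = arbitrary union_of (\<lambda>U. U \<in> sc_hat X ` \<BB>)"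


section \<open>The Stone space of a Boolean subalgebra\<close>

definition reg_ultrafilter :: "'a topology \<Rightarrow> 'a set set \<Rightarrow> 'a set set \<Rightarrow> bool" where
  "reg_ultrafilter X \<BB> s \<longleftrightarrow>
     s \<subseteq> \<BB> \<and> topspace X \<in> s \<and> {} \<notin> s \<and>
     (\<forall>A\<in>s. \<forall>B\<in>s. A \<inter> B \<in> s) \<and>
     (\<forall>A\<in>s. \<forall>B\<in>\<BB>. A \<subseteq> B \<longrightarrow> B \<in> s) \<and>
     (\<forall>B\<in>\<BB>. B \<in> s \<or> reg_compl X B \<in> s)"

definition star_set :: "'a topology \<Rightarrow> 'a set set \<Rightarrow> 'a set \<Rightarrow> 'a set set set" where
  "star_set X \<BB> B = {s. reg_ultrafilter X \<BB> s \<and> B \<in> s}"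

definition stone_space :: "'a topology \<Rightarrow> 'a set set \<Rightarrow> 'a set set topology" where
  "stone_space X \<BB> = topology_generated_by (star_set X \<BB> ` \<BB>)"

definition Clp :: "'b topology \<Rightarrow> 'b set set" where
  "Clp Y = {C. openin Y C \<and> closedin Y C}"

definition star_charge :: "'a topology \<Rightarrow> 'a set set \<Rightarrow> ('a set \<Rightarrow> real) \<Rightarrow> 'a set set set \<Rightarrow> real" where
  "star_charge X \<BB> \<mu> C = \<mu> (THE B. B \<in> \<BB> \<and> star_set X \<BB> B = C)"

definition stone_proj :: "'a topology \<Rightarrow> 'a set set \<Rightarrow> ('a \<Rightarrow> real) \<Rightarrow> real" where
  "stone_proj X s = the_elem (\<Inter>B\<in>s. stone_cech X closure_of sc_hat X B)"

definition star_fun :: "'a topology \<Rightarrow> ('a \<Rightarrow> real) \<Rightarrow> 'a set set \<Rightarrow> real" where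
  "star_fun X g = sc_ext X g \<circ> stone_proj X"


section \<open>Borel probability measures on a topological space\<close>

definition borel_prob :: "'b topology \<Rightarrow> 'b measure \<Rightarrow> bool" where
  "borel_prob Y M \<longleftrightarrow>
     prob_space M \<and> space M = topspace Y \<and> sets M = sigma_sets (topspace Y) {U. openin Y U}"

text \<open>A charge on the clopen algebra of a Stone space can have several Borel extensions: on
  \<open>\<omega>\<^sub>1 + 1\<close> the Dirac measure at \<open>\<omega>\<^sub>1\<close> and the Dieudonne measure agree on all clopen sets.
  Only the regular extension is unique on the whole Borel sigma-algebra.\<close>

definition regular_borel :: "'b topology \<Rightarrow> 'b measure \<Rightarrow> bool" where
  "regular_borel Y M \<longleftrightarrow>
     (\<forall>A\<in>sets M. emeasure M A = (INF U\<in>{U. openin Y U \<and> A \<subseteq> U}. emeasure M U) \<and>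
                  emeasure M A = (SUP K\<in>{K. compactin Y K \<and> K \<subseteq> A}. emeasure M K))"

definition extends_charge :: "'b topology \<Rightarrow> ('b set \<Rightarrow> real) \<Rightarrow> 'b measure \<Rightarrow> bool" where
  "extends_charge Y \<nu> M \<longleftrightarrow> (\<forall>C\<in>Clp Y. measure M C = \<nu> C)"


section \<open>Comeasurable functions and integration against a content\<close>

definition comeas :: "'a topology \<Rightarrow> 'a set set \<Rightarrow> ('a \<Rightarrow> real) set" where
  "comeas X \<BB> = {f \<in> bcont X. \<forall>r::real.
     X interior_of {x \<in> topspace X. f x \<le> r} \<in> \<BB> \<and>
     X interior_of {x \<in> topspace X. r \<le> f x} \<in> \<BB>}"

text \<open>The closed linear span of \<open>comeas X \<BB>\<close> in \<open>bcont X\<close> for the uniform norm on \<open>topspace X\<close>.\<close>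

definition comeas_span :: "'a topology \<Rightarrow> 'a set set \<Rightarrow> ('a \<Rightarrow> real) set" where
  "comeas_span X \<BB> = {g \<in> bcont X. \<forall>\<epsilon>>0. \<exists>F c. finite F \<and> F \<subseteq> comeas X \<BB> \<and>
     (\<forall>x\<in>topspace X. \<bar>g x - (\<Sum>f\<in>F. c f * f x)\<bar> < \<epsilon>)}"

definition reg_partition :: "'a topology \<Rightarrow> 'a set set \<Rightarrow> 'a set set \<Rightarrow> bool" where
  "reg_partition X \<BB> \<P> \<longleftrightarrow>
     finite \<P> \<and> \<P> \<subseteq> \<BB> \<and> pairwise disjnt \<P> \<and> reg_join X \<P> = topspace X"

text \<open>\<open>f\<close> takes the constant value \<open>r P\<close> on each cell \<open>P\<close>; the cells need not cover the space, and
  off the cells \<open>f\<close> is unconstrained (so the condition \<open>f \<le> g\<close> on \<open>D\<close> below costs nothing there).\<close>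

definition simple_repr ::
    "'a topology \<Rightarrow> 'a set set \<Rightarrow> ('a \<Rightarrow> real) \<Rightarrow> 'a set set \<Rightarrow> ('a set \<Rightarrow> real) \<Rightarrow> bool" where
  "simple_repr X \<BB> f \<P> r \<longleftrightarrow> reg_partition X \<BB> \<P> \<and> (\<forall>P\<in>\<P>. \<forall>x\<in>P. f x = r P)"

definition reg_simple :: "'a topology \<Rightarrow> 'a set set \<Rightarrow> ('a \<Rightarrow> real) \<Rightarrow> bool" where
  "reg_simple X \<BB> f \<longleftrightarrow> (\<exists>\<P> r. simple_repr X \<BB> f \<P> r)"

definition simple_integral ::
    "'a topology \<Rightarrow> 'a set set \<Rightarrow> ('a set \<Rightarrow> real) \<Rightarrow> 'a set \<Rightarrow> ('a \<Rightarrow> real) \<Rightarrow> real" where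
  "simple_integral X \<BB> \<mu> D f =
     (THE v. \<exists>\<P> r. simple_repr X \<BB> f \<P> r \<and> v = (\<Sum>P\<in>\<P>. r P * \<mu> (P \<inter> D)))"

definition content_integral ::
    "'a topology \<Rightarrow> 'a set set \<Rightarrow> ('a set \<Rightarrow> real) \<Rightarrow> 'a set \<Rightarrow> ('a \<Rightarrow> real) \<Rightarrow> real" where
  "content_integral X \<BB> \<mu> D g =
     (SUP f\<in>{f. reg_simple X \<BB> f \<and> (\<forall>x\<in>D. f x \<le> g x)}. simple_integral X \<BB> \<mu> D f)"

end

theory Submission
  imports Defs
begin

text \<open>The Stone space is compact, Hausdorff and zero-dimensional, so a finitely additive charge on its
  clopen sets already controls everything: approximating open sets from inside by clopen sets and
  arbitrary sets from outside by open sets gives an outer measure (countable subadditivity is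
  compactness), for which open sets are Caratheodory measurable; the resulting Borel measure is
  regular, and regularity forces uniqueness because a compact set is the filtered intersection of the
  clopen sets containing it.

  For the integral formula, cutting the range of a comeasurable function into short intervals yields
  a partition in the algebra on whose cells the function oscillates little, and this property passes to
  the closed span. If \<open>g \<ge> c\<close> on \<open>B\<close> then \<open>star_fun S g \<ge> c\<close> on \<open>star_set S \<BB> B\<close>, since \<open>stone_proj S\<close>
  maps the latter into the closure of \<open>B\<close>. Hence simple functions below \<open>g\<close> on \<open>D\<close> correspond to step
  functions below \<open>star_fun S g\<close> on \<open>star_set S \<BB> D\<close>, with the same integral, and both approximate
  uniformly.\<close>

section \<open>Extending charges on clopen sets\<close>

lemma Clp_Un: "A \<in> Clp Y \<Longrightarrow> B \<in> Clp Y \<Longrightarrow> A \<union> B \<in> Clp Y"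
  and Clp_Int: "A \<in> Clp Y \<Longrightarrow> B \<in> Clp Y \<Longrightarrow> A \<inter> B \<in> Clp Y"
  and Clp_Diff: "A \<in> Clp Y \<Longrightarrow> B \<in> Clp Y \<Longrightarrow> A - B \<in> Clp Y"
  and Clp_empty: "{} \<in> Clp Y"
  and Clp_topspace: "topspace Y \<in> Clp Y"
  by (auto simp: Clp_def openin_diff closedin_diff)

lemma Clp_Union: "finite \<C> \<Longrightarrow> \<C> \<subseteq> Clp Y \<Longrightarrow> \<Union>\<C> \<in> Clp Y"
  by (induction rule: finite_induct) (auto simp: Clp_empty Clp_Un)

lemma borel_prob_openin:
  assumes "borel_prob Y M" "openin Y U"
  shows "U \<in> sets M"
  using assms by (auto simp: borel_prob_def intro: sigma_sets.Basic)

lemma borel_prob_closedin: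
  assumes "borel_prob Y M" "closedin Y K"
  shows "K \<in> sets M"
proof -
  have "space M - (topspace Y - K) \<in> sets M"
    using borel_prob_openin[OF assms(1), of "topspace Y - K"] assms(2)
    by (intro sets.compl_sets) (simp add: closedin_def)
  moreover have "space M - (topspace Y - K) = K"
    using closedin_subset[OF assms(2)] assms(1) by (auto simp: borel_prob_def)
  ultimately show ?thesis by simp
qed

section \<open>Agreement of measures on the sigma-algebra generated by the clopen sets\<close>

text \<open>Dynkin's pi-lambda argument: clopen sets are stable under intersection, and agreement of
  two probability measures survives complements and disjoint countable unions. It settles uniqueness
  on the sigma-algebra generated by the clopen sets, which can be smaller than the Borel
  one.\<close>

lemma charge_extensions_agree:
  assumes M: "borel_prob Y M" "extends_charge Y \<nu> M"
    and N: "borel_prob Y N" "extends_charge Y \<nu> N"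
    and A: "A \<in> sigma_sets (topspace Y) (Clp Y)"
  shows "emeasure M A = emeasure N A"
proof -
  interpret M: prob_space M using M by (simp add: borel_prob_def)
  interpret N: prob_space N using N by (simp add: borel_prob_def)
  have sub: "Clp Y \<subseteq> Pow (topspace Y)" using openin_subset by (auto simp: Clp_def)
  have eq: "emeasure M C = emeasure N C" if "C \<in> Clp Y" for C
    using that M(2) N(2) by (simp add: extends_charge_def M.emeasure_eq_measure N.emeasure_eq_measure)
  have "Int_stable (Clp Y)" by (auto simp: Int_stable_def Clp_Int)
  then show ?thesis using sub A
  proof (induction rule: sigma_sets_induct_disjoint)
    case (basic A) then show ?case by (rule eq)
  next
    case empty show ?case by simp
  next
    case (compl A)
    have "sigma_sets (topspace Y) (Clp Y) \<subseteq> sigma_sets (topspace Y) {U. openin Y U}"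
      by (rule sigma_sets_mono') (auto simp: Clp_def)
    then have "A \<in> sets M" "A \<in> sets N" using compl.hyps M N by (auto simp: borel_prob_def)
    moreover have sp: "space M = topspace Y" "space N = topspace Y"
      using M N by (auto simp: borel_prob_def)
    ultimately show ?case
      using compl.IH eq[OF Clp_topspace] emeasure_compl[of A M] emeasure_compl[of A N] by simp
  next
    case (union A)
    have "sigma_sets (topspace Y) (Clp Y) \<subseteq> sigma_sets (topspace Y) {U. openin Y U}"
      by (rule sigma_sets_mono') (auto simp: Clp_def)
    then have "range A \<subseteq> sets M" "range A \<subseteq> sets N" using union.hyps M N by (auto simp: borel_prob_def)
    with union show ?case using suminf_emeasure[of A M] suminf_emeasure[of A N] by simp
  qed
qed

section \<open>Charges on a compact Hausdorff space with a clopen base\<close>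

locale clopen_charge =
  fixes Y :: "'b topology" and \<nu> :: "'b set \<Rightarrow> real"
  assumes compact: "compact_space Y" and Hausdorff: "Hausdorff_space Y"
    and base: "\<And>U x. openin Y U \<Longrightarrow> x \<in> U \<Longrightarrow> \<exists>C\<in>Clp Y. x \<in> C \<and> C \<subseteq> U"
    and nonneg: "\<And>C. C \<in> Clp Y \<Longrightarrow> 0 \<le> \<nu> C"
    and add: "\<And>C D. C \<in> Clp Y \<Longrightarrow> D \<in> Clp Y \<Longrightarrow> C \<inter> D = {} \<Longrightarrow> \<nu> (C \<union> D) = \<nu> C + \<nu> D"
    and total: "\<nu> (topspace Y) = 1"
begin

lemma charge_empty: "\<nu> {} = 0"
  using add[of "{}" "{}"] by (simp add: Clp_empty)

lemma charge_mono:
  assumes "C \<in> Clp Y" "D \<in> Clp Y" "C \<subseteq> D"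
  shows "\<nu> C \<le> \<nu> D"
proof -
  have "\<nu> (C \<union> (D - C)) = \<nu> C + \<nu> (D - C)" using assms by (intro add) (auto intro: Clp_Diff)
  moreover have "C \<union> (D - C) = D" using assms by auto
  moreover have "0 \<le> \<nu> (D - C)" using assms by (intro nonneg Clp_Diff)
  ultimately show ?thesis by simp
qed

lemma charge_Un_le:
  assumes "C \<in> Clp Y" "D \<in> Clp Y"
  shows "\<nu> (C \<union> D) \<le> \<nu> C + \<nu> D"
proof -
  have "\<nu> (C \<union> (D - C)) = \<nu> C + \<nu> (D - C)" using assms by (intro add) (auto intro: Clp_Diff)
  moreover have "\<nu> (D - C) \<le> \<nu> D" using assms by (intro charge_mono Clp_Diff) auto
  ultimately show ?thesis by simp
qed

lemma charge_UN_le: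
  assumes "\<And>i::nat. E i \<in> Clp Y"
  shows "(\<Union>i<n. E i) \<in> Clp Y \<and> \<nu> (\<Union>i<n. E i) \<le> (\<Sum>i<n. \<nu> (E i))"
proof (induction n)
  case 0 show ?case by (simp add: Clp_empty charge_empty)
next
  case (Suc n)
  have "(\<Union>i<Suc n. E i) = (\<Union>i<n. E i) \<union> E n" by (auto simp: lessThan_Suc)
  with Suc show ?case using charge_Un_le[OF _ assms, of "\<Union>i<n. E i" n] Clp_Un[OF _ assms] by auto
qed

text \<open>By \<open>base\<close>, the clopen sets contained in some member of \<open>\<U>\<close>
  still cover \<open>K\<close>; compactness selects finitely many. Clopen pieces are wanted because
  the charge is defined on them.\<close>

lemma clopen_subcover:
  assumes K: "compactin Y K" and \<U>: "\<And>U. U \<in> \<U> \<Longrightarrow> openin Y U" "K \<subseteq> \<Union>\<U>"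
  obtains \<F> where "finite \<F>" "\<F> \<subseteq> Clp Y" "\<forall>D\<in>\<F>. \<exists>U\<in>\<U>. D \<subseteq> U" "K \<subseteq> \<Union>\<F>"
proof -
  let ?\<D> = "{D \<in> Clp Y. \<exists>U\<in>\<U>. D \<subseteq> U}"
  have "K \<subseteq> \<Union>?\<D>"
  proof
    fix x assume "x \<in> K"
    then obtain U where "U \<in> \<U>" "x \<in> U" using \<U> by auto
    with base[OF \<U>(1), of U x] show "x \<in> \<Union>?\<D>" by auto
  qed
  moreover have "\<And>D. D \<in> ?\<D> \<Longrightarrow> openin Y D" by (auto simp: Clp_def)
  ultimately obtain \<F> where "finite \<F>" "\<F> \<subseteq> ?\<D>" "K \<subseteq> \<Union>\<F>" using compactinD[OF K] by meson
  then show ?thesis by (intro that[of \<F>]) auto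
qed

section \<open>Inner and outer set functions of a charge\<close>

text \<open>Intended as the measure of an open set, exhausted by clopen sets from inside. Values in
  \<open>ennreal\<close> free suprema and infinite sums from side conditions.\<close>

definition inner :: "'b set \<Rightarrow> ennreal" where
  "inner U = (SUP C\<in>{C \<in> Clp Y. C \<subseteq> U}. ennreal (\<nu> C))"

definition outer :: "'b set \<Rightarrow> ennreal" where
  "outer A = (INF U\<in>{U. openin Y U \<and> A \<subseteq> U}. inner U)"

lemma inner_mono: "U \<subseteq> V \<Longrightarrow> inner U \<le> inner V"
  unfolding inner_def by (rule SUP_subset_mono) auto

lemma outer_mono: "A \<subseteq> B \<Longrightarrow> outer A \<le> outer B"
  unfolding outer_def by (rule INF_superset_mono) auto

lemma charge_le_inner: "C \<in> Clp Y \<Longrightarrow> C \<subseteq> U \<Longrightarrow> ennreal (\<nu> C) \<le> inner U"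
  unfolding inner_def by (rule SUP_upper) auto

lemma outer_le_inner: "openin Y U \<Longrightarrow> A \<subseteq> U \<Longrightarrow> outer A \<le> inner U"
  unfolding outer_def by (rule INF_lower) auto

lemma outer_open: "openin Y U \<Longrightarrow> outer U = inner U"
  by (rule antisym[OF outer_le_inner]) (auto simp: outer_def intro!: INF_greatest inner_mono)

lemma inner_clopen: "C \<in> Clp Y \<Longrightarrow> inner C = ennreal (\<nu> C)"
  unfolding inner_def
  by (rule antisym[OF SUP_least SUP_upper]) (auto intro!: ennreal_leI charge_mono)

lemma outer_clopen: "C \<in> Clp Y \<Longrightarrow> outer C = ennreal (\<nu> C)"
  using outer_open[of C] by (simp add: inner_clopen) (simp add: Clp_def)

text \<open>Compactness replaces countable additivity: a clopen subset of the union splits into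
  finitely many clopen pieces, each inside one \<open>U i\<close>, so finite subadditivity of the
  charge is enough.\<close>

lemma inner_UN_le:
  assumes U: "\<And>i::nat. openin Y (U i)"
  shows "inner (\<Union>i. U i) \<le> (\<Sum>i. inner (U i))"
  unfolding inner_def[of "\<Union>i. U i"]
proof (rule SUP_least)
  fix C assume "C \<in> {C \<in> Clp Y. C \<subseteq> (\<Union>i. U i)}"
  then have C: "C \<in> Clp Y" "C \<subseteq> (\<Union>i. U i)" by auto
  have "compactin Y C" using C compact by (auto simp: Clp_def closedin_compact_space)
  then obtain \<F> where \<F>: "finite \<F>" "\<F> \<subseteq> Clp Y" "\<forall>D\<in>\<F>. \<exists>V\<in>range U. D \<subseteq> V" "C \<subseteq> \<Union>\<F>"
    using clopen_subcover[of C "range U"] U C(2) by blast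
  then have "\<forall>D\<in>\<F>. \<exists>i. D \<subseteq> U i" by blast
  then obtain idx where idx: "\<And>D. D \<in> \<F> \<Longrightarrow> D \<subseteq> U (idx D)" unfolding bchoice_iff by blast
  obtain n where n: "\<And>D. D \<in> \<F> \<Longrightarrow> idx D < n"
    using \<open>finite \<F>\<close> finite_nat_set_iff_bounded[of "idx ` \<F>"] by auto
  \<comment> \<open>Grouping by index leaves one clopen piece per \<open>U i\<close>, so that the
    finite sum can be compared with the series term by term; intersecting with \<open>C\<close>
    makes the union exactly \<open>C\<close>.\<close>
  define E where "E i = C \<inter> \<Union>{D \<in> \<F>. idx D = i}" for i
  have E: "E i \<in> Clp Y" "E i \<subseteq> U i" for i
    using \<F> C idx unfolding E_def by (auto intro!: Clp_Int Clp_Union) blast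
  have "C = (\<Union>i<n. E i)" using \<F>(4) n by (auto simp: E_def) blast
  then have "\<nu> C \<le> (\<Sum>i<n. \<nu> (E i))" using charge_UN_le[of E n, OF E(1)] by simp
  then have "ennreal (\<nu> C) \<le> (\<Sum>i<n. ennreal (\<nu> (E i)))"
    by (subst sum_ennreal) (auto intro: nonneg E ennreal_leI)
  also have "\<dots> \<le> (\<Sum>i<n. inner (U i))" by (intro sum_mono charge_le_inner E)
  also have "\<dots> \<le> (\<Sum>i. inner (U i))" by (intro sum_le_suminf) auto
  finally show "ennreal (\<nu> C) \<le> (\<Sum>i. inner (U i))" .
qed

text \<open>Each \<open>A n\<close> is enclosed in an open set whose \<open>inner\<close> value
  exceeds \<open>outer (A n)\<close> by less than the n-th term of a series with sum
  \<open>e\<close>; then \<open>inner_UN_le\<close> applies to the open sets.\<close>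

lemma outer_countably_subadditive: "countably_subadditive (Pow (topspace Y)) outer"
  unfolding countably_subadditive_def
proof (intro allI impI)
  fix A :: "nat \<Rightarrow> 'b set"
  show "outer (\<Union>i. A i) \<le> (\<Sum>i. outer (A i))"
  proof (rule ennreal_le_epsilon)
    fix e :: real assume e: "0 < e" "(\<Sum>i. outer (A i)) < top"
    \<comment> \<open>Finiteness of the sum makes every term finite, so adding a positive amount is
      a strict increase.\<close>
    then have "outer (A n) < outer (A n) + e * (1/2) ^ Suc n" for n
      by (auto simp add: less_top dest!: ennreal_suminf_lessD)
    then have "\<exists>U. openin Y U \<and> A n \<subseteq> U \<and> inner U < outer (A n) + e * (1/2) ^ Suc n" for n
      unfolding outer_def INF_less_iff by blast
    then obtain U where U: "\<And>n. openin Y (U n)" "\<And>n. A n \<subseteq> U n"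
        "\<And>n. inner (U n) < outer (A n) + e * (1/2) ^ Suc n"
      by metis
    have "outer (\<Union>i. A i) \<le> inner (\<Union>i. U i)"
      using U by (intro outer_le_inner openin_Union UN_mono) auto
    also have "\<dots> \<le> (\<Sum>i. inner (U i))" by (rule inner_UN_le[OF U(1)])
    also have "\<dots> \<le> (\<Sum>n. outer (A n) + e * (1/2) ^ Suc n)"
      using U(3) by (intro suminf_le) (auto intro: less_imp_le)
    also have "\<dots> = (\<Sum>n. outer (A n)) + (\<Sum>n. ennreal e * ennreal ((1/2) ^ Suc n))"
      using e(1) by (subst suminf_add[symmetric])
        (auto simp del: ennreal_suminf_cmult simp add: ennreal_mult[symmetric])
    also have "\<dots> = (\<Sum>n. outer (A n)) + e"
      unfolding ennreal_suminf_cmult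
      by (subst suminf_ennreal_eq[OF zero_le_power power_half_series]) auto
    finally show "outer (\<Union>i. A i) \<le> (\<Sum>n. outer (A n)) + ennreal e" .
  qed
qed

text \<open>The nontrivial half of Caratheodory's condition for open sets. Given open
  \<open>U\<close> containing \<open>A\<close> and clopen \<open>C \<subseteq> U \<inter> V\<close>,
  the open set \<open>U - C\<close> contains \<open>A - V\<close>, and a clopen
  \<open>E \<subseteq> U - C\<close> is disjoint from \<open>C\<close>, whence
  \<open>\<nu> C + \<nu> E \<le> inner U\<close>. Taking suprema over \<open>E\<close> and then over
  \<open>C\<close> gives the claim.\<close>

lemma outer_split:
  assumes V: "openin Y V"
  shows "outer (A \<inter> V) + outer (A - V) \<le> outer A"
  unfolding outer_def[of A]
proof (rule INF_greatest)
  fix U assume "U \<in> {U. openin Y U \<and> A \<subseteq> U}"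
  then have U: "openin Y U" "A \<subseteq> U" by auto
  \<comment> \<open>A constant may be moved into a supremum in \<open>ennreal\<close> only over a
    nonempty family.\<close>
  have ne: "{C \<in> Clp Y. C \<subseteq> W} \<noteq> {}" for W using Clp_empty by auto
  have *: "ennreal (\<nu> C) + outer (A - V) \<le> inner U" if C: "C \<in> Clp Y" "C \<subseteq> U \<inter> V" for C
  proof -
    have "outer (A - V) \<le> inner (U - C)"
      using U C by (intro outer_le_inner openin_diff) (auto simp: Clp_def)
    then have "ennreal (\<nu> C) + outer (A - V) \<le> ennreal (\<nu> C) + inner (U - C)"
      by (rule add_left_mono)
    also have "\<dots> = (SUP E\<in>{E \<in> Clp Y. E \<subseteq> U - C}. ennreal (\<nu> C) + ennreal (\<nu> E))"
      unfolding inner_def by (rule ennreal_SUP_add_right[OF ne])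
    also have "\<dots> \<le> inner U"
    proof (rule SUP_least)
      fix E assume E: "E \<in> {E \<in> Clp Y. E \<subseteq> U - C}"
      then have "ennreal (\<nu> C) + ennreal (\<nu> E) = ennreal (\<nu> (C \<union> E))"
        using C by (subst add) (auto simp: nonneg)
      also have "\<dots> \<le> inner U" using C E by (intro charge_le_inner Clp_Un) auto
      finally show "ennreal (\<nu> C) + ennreal (\<nu> E) \<le> inner U" .
    qed
    finally show ?thesis .
  qed
  have "outer (A \<inter> V) + outer (A - V) \<le> inner (U \<inter> V) + outer (A - V)"
    using U V by (intro add_right_mono outer_le_inner) auto
  also have "\<dots> = (SUP C\<in>{C \<in> Clp Y. C \<subseteq> U \<inter> V}. ennreal (\<nu> C) + outer (A - V))"
    unfolding inner_def by (rule ennreal_SUP_add_left[symmetric, OF ne])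
  also have "\<dots> \<le> inner U" using * by (intro SUP_least) auto
  finally show "outer (A \<inter> V) + outer (A - V) \<le> inner U" .
qed

lemma outer_measure_space_outer: "outer_measure_space (Pow (topspace Y)) outer"
  unfolding outer_measure_space_def
  using outer_countably_subadditive outer_clopen[OF Clp_empty] outer_mono
  by (auto simp: positive_def increasing_def charge_empty)

section \<open>The regular Borel extension\<close>

text \<open>\<open>measure_of\<close> returns the values of \<open>outer\<close> only if
  \<open>outer\<close> is a measure on the Borel sets, and zero otherwise;
  \<open>emeasure_extension\<close> rules out the second case.\<close>

definition extension :: "'b measure" where
  "extension = measure_of (topspace Y) {U. openin Y U} outer"

lemma space_extension: "space extension = topspace Y"
  and sets_extension: "sets extension = sigma_sets (topspace Y) {U. openin Y U}"
  using openin_subset by (auto simp: extension_def intro!: space_measure_of sets_measure_of)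

text \<open>Caratheodory's theorem: \<open>outer\<close> is a measure on the sigma-algebra of its
  measurable sets. Open sets are measurable by \<open>outer_split\<close> and subadditivity, hence
  so are all Borel sets.\<close>

lemma emeasure_extension:
  assumes "A \<in> sets extension"
  shows "emeasure extension A = outer A"
proof -
  let ?P = "Pow (topspace Y)" and ?B = "sigma_sets (topspace Y) {U. openin Y U}"
  let ?L = "lambda_system (topspace Y) ?P outer"
  have ms: "measure_space (topspace Y) ?L outer"
    by (rule sigma_algebra.caratheodory_lemma[OF sigma_algebra_Pow outer_measure_space_outer])
  have "{U. openin Y U} \<subseteq> ?L"
  proof (unfold lambda_system_def, intro subsetI CollectI conjI ballI)
    fix U assume "U \<in> {U. openin Y U}"
    then show "U \<in> ?P" using openin_subset by auto
  next
    fix U x assume "U \<in> {U. openin Y U}" and "x \<in> ?P"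
    then have U: "openin Y U" and x: "x \<subseteq> topspace Y" by auto
    have "outer ((x \<inter> U) \<union> (x - U)) \<le> outer (x \<inter> U) + outer (x - U)"
    proof -
      \<comment> \<open>A union of two sets, padded with empty sets to a countable one.\<close>
      let ?A = "binaryset (x \<inter> U) (x - U)"
      have "outer (\<Union>i. ?A i) \<le> (\<Sum>i. outer (?A i))"
        using x by (intro outer_countably_subadditive[unfolded countably_subadditive_def, rule_format])
          (auto simp: range_binaryset_eq disjoint_family_on_def binaryset_def)
      then show ?thesis
        using outer_clopen[OF Clp_empty] charge_empty
        by (simp add: UN_binaryset_eq suminf_binaryset_eq)
    qed
    moreover have "(x \<inter> U) \<union> (x - U) = x" "(topspace Y - U) \<inter> x = x - U"
      using x by auto
    ultimately show "outer (U \<inter> x) + outer ((topspace Y - U) \<inter> x) = outer x"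
      using outer_split[OF U, of x] by (simp add: antisym Int_commute[of U x])
  qed
  then have sub: "?B \<subseteq> ?L"
    using ms by (intro sigma_algebra.sigma_sets_subset) (auto simp: measure_space_def)
  have "measure_space (topspace Y) ?B outer"
    by (rule measure_down[OF ms sigma_algebra_sigma_sets sub]) (use openin_subset in auto)
  then show ?thesis
    using assms openin_subset
    by (intro emeasure_measure_of[OF extension_def]) (auto simp: measure_space_def sets_extension)
qed

lemma borel_prob_extension: "borel_prob Y extension"
proof -
  have "topspace Y \<in> sets extension"
    unfolding sets_extension by (rule sigma_sets_top)
  then have "emeasure extension (space extension) = 1"
    by (simp add: space_extension emeasure_extension outer_clopen Clp_topspace total)
  then show ?thesis
    by (simp add: borel_prob_def space_extension sets_extension prob_spaceI)
qed

lemma extends_charge_extension: "extends_charge Y \<nu> extension"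
  unfolding extends_charge_def
proof
  fix C assume C: "C \<in> Clp Y"
  then have "C \<in> sets extension" using borel_prob_openin[OF borel_prob_extension] by (auto simp: Clp_def)
  then show "measure extension C = \<nu> C"
    using C by (simp add: measure_def emeasure_extension outer_clopen nonneg)
qed

text \<open>Outer regularity is built into \<open>outer\<close>. Inner regularity follows by
  complements: an open set slightly larger than the complement of \<open>A\<close> has a compact
  complement inside \<open>A\<close>, and total mass one turns the small excess into a small
  deficit.\<close>

lemma regular_borel_extension: "regular_borel Y extension"
  unfolding regular_borel_def
proof (intro ballI conjI)
  interpret prob_space extension using borel_prob_extension by (simp add: borel_prob_def)
  have outer_reg: "emeasure extension A = (INF U\<in>{U. openin Y U \<and> A \<subseteq> U}. emeasure extension U)"
    if "A \<in> sets extension" for A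
  proof -
    have "emeasure extension U = inner U" if "openin Y U" for U
      using borel_prob_openin[OF borel_prob_extension that] that
      by (simp add: emeasure_extension outer_open)
    then have "(INF U\<in>{U. openin Y U \<and> A \<subseteq> U}. emeasure extension U) = outer A"
      unfolding outer_def by (intro INF_cong) auto
    then show ?thesis using that by (simp add: emeasure_extension)
  qed
  fix A assume A: "A \<in> sets extension"
  show "emeasure extension A = (INF U\<in>{U. openin Y U \<and> A \<subseteq> U}. emeasure extension U)"
    by (rule outer_reg[OF A])
  show "emeasure extension A = (SUP K\<in>{K. compactin Y K \<and> K \<subseteq> A}. emeasure extension K)"
  proof (rule antisym)
    show "(SUP K\<in>{K. compactin Y K \<and> K \<subseteq> A}. emeasure extension K) \<le> emeasure extension A"
      using A by (intro SUP_least emeasure_mono) auto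
    show "emeasure extension A \<le> (SUP K\<in>{K. compactin Y K \<and> K \<subseteq> A}. emeasure extension K)"
    proof (rule ennreal_le_epsilon)
      fix e :: real assume e: "0 < e"
      let ?A' = "topspace Y - A"
      have A': "?A' \<in> sets extension" using A by (auto simp flip: space_extension)
      have "emeasure extension ?A' < emeasure extension ?A' + e"
        using e by (simp add: emeasure_eq_measure ennreal_less_iff flip: ennreal_plus)
      then obtain U where U: "openin Y U" "?A' \<subseteq> U" "emeasure extension U < emeasure extension ?A' + e"
        using outer_reg[OF A'] by (auto simp: INF_less_iff)
      let ?K = "topspace Y - U"
      have K: "compactin Y ?K" "?K \<subseteq> A"
        using U compact by (auto intro: closedin_compact_space)
      have sU: "U \<in> sets extension" using U(1) by (rule borel_prob_openin[OF borel_prob_extension])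
      have "measure extension U < measure extension ?A' + e"
        using U(3) e by (simp add: emeasure_eq_measure ennreal_less_iff flip: ennreal_plus)
      then have "measure extension A \<le> measure extension ?K + e"
        using prob_compl[OF sU] prob_compl[OF A] by (simp add: space_extension)
      then have "emeasure extension A \<le> emeasure extension ?K + e"
        using e by (simp add: emeasure_eq_measure flip: ennreal_plus)
      also have "\<dots> \<le> (SUP K\<in>{K. compactin Y K \<and> K \<subseteq> A}. emeasure extension K) + e"
        using K by (intro add_right_mono SUP_upper) auto
      finally show "emeasure extension A \<le> (SUP K\<in>{K. compactin Y K \<and> K \<subseteq> A}. emeasure extension K) + e" .
    qed
  qed
qed

section \<open>Uniqueness of the regular extension\<close>

lemma clopen_between:
  assumes K: "compactin Y K" and U: "openin Y U" "K \<subseteq> U"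
  obtains C where "C \<in> Clp Y" "K \<subseteq> C" "C \<subseteq> U"
proof -
  obtain \<F> where "finite \<F>" "\<F> \<subseteq> Clp Y" "\<forall>D\<in>\<F>. \<exists>V\<in>{U}. D \<subseteq> V" "K \<subseteq> \<Union>\<F>"
    using clopen_subcover[OF K, of "{U}"] U by auto
  then show ?thesis by (intro that[of "\<Union>\<F>"] Clp_Union) auto
qed

text \<open>By outer regularity the measure is an infimum over open supersets, and
  \<open>clopen_between\<close> shows that the clopen ones are cofinal among these. The right-hand
  side mentions only the charge, so regular extensions agree on compact sets.\<close>

lemma emeasure_compactin_extension:
  assumes M: "borel_prob Y M" "regular_borel Y M" "extends_charge Y \<nu> M" and K: "compactin Y K"
  shows "emeasure M K = (INF C\<in>{C \<in> Clp Y. K \<subseteq> C}. ennreal (\<nu> C))"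
proof -
  interpret prob_space M using M by (simp add: borel_prob_def)
  have eq: "emeasure M C = ennreal (\<nu> C)" if "C \<in> Clp Y" for C
    using M(3) that by (simp add: extends_charge_def emeasure_eq_measure)
  have sets: "K \<in> sets M"
    using compactin_imp_closedin[OF Hausdorff K] by (rule borel_prob_closedin[OF M(1)])
  have "emeasure M K = (INF U\<in>{U. openin Y U \<and> K \<subseteq> U}. emeasure M U)"
    using M(2) sets by (simp add: regular_borel_def)
  also have "\<dots> = (INF C\<in>{C \<in> Clp Y. K \<subseteq> C}. ennreal (\<nu> C))"
  proof (rule INF_eq)
    fix U assume "U \<in> {U. openin Y U \<and> K \<subseteq> U}"
    then have U: "openin Y U" "K \<subseteq> U" by auto
    then obtain C where C: "C \<in> Clp Y" "K \<subseteq> C" "C \<subseteq> U" using clopen_between[OF K] by metis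
    then have "ennreal (\<nu> C) \<le> emeasure M U"
      using emeasure_mono[OF C(3) borel_prob_openin[OF M(1) U(1)]] by (simp add: eq)
    with C show "\<exists>C\<in>{C \<in> Clp Y. K \<subseteq> C}. ennreal (\<nu> C) \<le> emeasure M U" by auto
  next
    fix C assume "C \<in> {C \<in> Clp Y. K \<subseteq> C}"
    then show "\<exists>U\<in>{U. openin Y U \<and> K \<subseteq> U}. emeasure M U \<le> ennreal (\<nu> C)"
      by (intro bexI[of _ C]) (auto simp: eq, auto simp: Clp_def)
  qed
  finally show ?thesis .
qed

theorem ex1_regular_extension:
  "\<exists>!M. borel_prob Y M \<and> regular_borel Y M \<and> extends_charge Y \<nu> M"
proof (rule ex1I)
  show "borel_prob Y extension \<and> regular_borel Y extension \<and> extends_charge Y \<nu> extension"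
    by (intro conjI borel_prob_extension regular_borel_extension extends_charge_extension)
  fix M assume M: "borel_prob Y M \<and> regular_borel Y M \<and> extends_charge Y \<nu> M"
  have sets: "sets M = sets extension" using M by (simp add: borel_prob_def sets_extension)
  show "M = extension"
  proof (rule measure_eqI[OF sets])
    fix A assume A: "A \<in> sets M"
    have "emeasure M K = emeasure extension K" if "compactin Y K" for K
      using emeasure_compactin_extension[OF _ _ _ that, of M]
        emeasure_compactin_extension[OF borel_prob_extension regular_borel_extension
          extends_charge_extension that] M by simp
    \<comment> \<open>Inner regularity carries agreement from compact sets to all Borel
      sets.\<close>
    then have "(SUP K\<in>{K. compactin Y K \<and> K \<subseteq> A}. emeasure M K) =
        (SUP K\<in>{K. compactin Y K \<and> K \<subseteq> A}. emeasure extension K)"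
      by (intro SUP_cong) auto
    then show "emeasure M A = emeasure extension A"
      using M regular_borel_extension A sets unfolding regular_borel_def by (metis (no_types, lifting))
  qed
qed

end

section \<open>The Stone space of an algebra of regular open sets\<close>

lemma reg_compl_eq: "reg_compl X B = topspace X - X closure_of B"
  by (simp add: reg_compl_def interior_of_complement)

lemma reg_compl_disjoint: "B \<inter> reg_compl X B = {}"
  using interior_of_subset[of X "topspace X - B"] by (auto simp: reg_compl_def)

lemma reg_compl_maximal: "openin X A \<Longrightarrow> A \<inter> B = {} \<Longrightarrow> A \<subseteq> reg_compl X B"
  unfolding reg_compl_def by (rule interior_of_maximal) (use openin_subset in auto)

lemma reg_compl_empty: "reg_compl X {} = topspace X"
  by (simp add: reg_compl_eq)

lemma reg_compl_reg_compl: "regular_open X B \<Longrightarrow> reg_compl X (reg_compl X B) = B"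
  using interior_of_closure_of[of X "X closure_of B"] by (simp add: regular_open_def reg_compl_eq)

text \<open>The substitute for excluded middle: \<open>B\<close> and its complement need not cover
  the space, but their union is dense in it.\<close>

lemma open_meets_reg_compl:
  assumes "openin X A" "A \<inter> B = {}" "A \<inter> reg_compl X B = {}"
  shows "A = {}"
  using reg_compl_maximal[OF assms(1,2)] assms(3) by auto

lemma subset_reg_join: "(\<And>B. B \<in> \<Q> \<Longrightarrow> openin X B) \<Longrightarrow> \<Union>\<Q> \<subseteq> reg_join X \<Q>"
  unfolding reg_join_def by (intro interior_of_maximal closure_of_subset) (auto dest: openin_subset)

lemma open_meets_reg_join:
  assumes "openin X A" "A \<inter> \<Union>\<Q> = {}"
  shows "A \<inter> reg_join X \<Q> = {}"
  using openin_Int_closure_of_eq_empty[OF assms(1), of "\<Union>\<Q>"] assms(2)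
    interior_of_subset[of X "X closure_of \<Union>\<Q>"] by (auto simp: reg_join_def)

text \<open>Both sides express density of the union. The form with open sets is the one that later
  arguments about partitions use.\<close>

lemma reg_join_eq_topspace:
  "reg_join X \<Q> = topspace X \<longleftrightarrow> (\<forall>A. openin X A \<longrightarrow> A \<inter> \<Union>\<Q> = {} \<longrightarrow> A = {})"
proof
  assume "reg_join X \<Q> = topspace X"
  then show "\<forall>A. openin X A \<longrightarrow> A \<inter> \<Union>\<Q> = {} \<longrightarrow> A = {}"
    by (metis Int_absorb2 open_meets_reg_join openin_subset)
next
  assume "\<forall>A. openin X A \<longrightarrow> A \<inter> \<Union>\<Q> = {} \<longrightarrow> A = {}"
  then have "X closure_of \<Union>\<Q> = topspace X" by (auto simp: dense_intersects_open Int_commute)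
  then show "reg_join X \<Q> = topspace X" by (simp add: reg_join_def)
qed

section \<open>Ultrafilters of a subalgebra\<close>

locale reg_algebra =
  fixes S :: "'a topology" and \<BB> :: "'a set set"
  assumes subalgebra: "reg_subalgebra S \<BB>"
begin

lemma regular: "B \<in> \<BB> \<Longrightarrow> regular_open S B"
  and Int_mem: "A \<in> \<BB> \<Longrightarrow> B \<in> \<BB> \<Longrightarrow> A \<inter> B \<in> \<BB>"
  and join_mem: "A \<in> \<BB> \<Longrightarrow> B \<in> \<BB> \<Longrightarrow> reg_join S {A, B} \<in> \<BB>"
  and compl_mem: "B \<in> \<BB> \<Longrightarrow> reg_compl S B \<in> \<BB>"
  using subalgebra by (auto simp: reg_subalgebra_def)

lemma open_mem: "B \<in> \<BB> \<Longrightarrow> openin S B"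
  using regular by (auto simp: regular_open_def)

lemma mem_subset: "B \<in> \<BB> \<Longrightarrow> B \<subseteq> topspace S"
  using open_mem openin_subset by blast

lemma empty_mem: "{} \<in> \<BB>"
proof -
  obtain B where "B \<in> \<BB>" using subalgebra by (auto simp: reg_subalgebra_def)
  then have "B \<inter> reg_compl S B \<in> \<BB>" by (intro Int_mem compl_mem)
  then show ?thesis by (simp add: reg_compl_disjoint)
qed

lemma topspace_mem: "topspace S \<in> \<BB>"
  using compl_mem[OF empty_mem] by (simp add: reg_compl_empty)

lemma Inter_mem: "finite \<F> \<Longrightarrow> \<F> \<subseteq> \<BB> \<Longrightarrow> topspace S \<inter> \<Inter>\<F> \<in> \<BB>"
  by (induction rule: finite_induct) (auto simp: topspace_mem Int_mem Int_left_commute)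

abbreviation "star \<equiv> star_set S \<BB>"
abbreviation "stone \<equiv> stone_space S \<BB>"
abbreviation "ultra \<equiv> reg_ultrafilter S \<BB>"

lemma ultra_subset: "ultra s \<Longrightarrow> s \<subseteq> \<BB>"
  and ultra_topspace: "ultra s \<Longrightarrow> topspace S \<in> s"
  and ultra_empty: "ultra s \<Longrightarrow> {} \<notin> s"
  and ultra_Int: "ultra s \<Longrightarrow> A \<in> s \<Longrightarrow> B \<in> s \<Longrightarrow> A \<inter> B \<in> s"
  and ultra_mono: "ultra s \<Longrightarrow> A \<in> s \<Longrightarrow> B \<in> \<BB> \<Longrightarrow> A \<subseteq> B \<Longrightarrow> B \<in> s"
  and ultra_dichotomy: "ultra s \<Longrightarrow> B \<in> \<BB> \<Longrightarrow> B \<in> s \<or> reg_compl S B \<in> s"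
  unfolding reg_ultrafilter_def by blast+

lemma ultra_compl_iff:
  assumes "ultra s" "B \<in> \<BB>"
  shows "reg_compl S B \<in> s \<longleftrightarrow> B \<notin> s"
  using ultra_dichotomy[OF assms] ultra_Int[OF assms(1), of B "reg_compl S B"] ultra_empty[OF assms(1)]
  by (auto simp: reg_compl_disjoint)

lemma ultra_Inter: "finite \<F> \<Longrightarrow> \<F> \<subseteq> s \<Longrightarrow> ultra s \<Longrightarrow> topspace S \<inter> \<Inter>\<F> \<in> s"
  by (induction rule: finite_induct) (auto simp: ultra_topspace ultra_Int Int_left_commute)

text \<open>A family that is maximal with the finite intersection property is an ultrafilter.\<close>

lemma ultrafilter_extension:
  assumes "G \<subseteq> \<BB>" and fip: "\<And>\<F>. finite \<F> \<Longrightarrow> \<F> \<subseteq> G \<Longrightarrow> topspace S \<inter> \<Inter>\<F> \<noteq> {}"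
  obtains s where "ultra s" "G \<subseteq> s"
proof -
  let ?fip = "\<lambda>H. \<forall>\<F>. finite \<F> \<longrightarrow> \<F> \<subseteq> H \<longrightarrow> topspace S \<inter> \<Inter>\<F> \<noteq> {}"
  let ?A = "{H. G \<subseteq> H \<and> H \<subseteq> \<BB> \<and> ?fip H}"
  have "\<exists>s\<in>?A. \<forall>H\<in>?A. s \<subseteq> H \<longrightarrow> H = s"
  proof (rule subset_Zorn_nonempty)
    show "?A \<noteq> {}" using assms by blast
    fix \<C> assume \<C>: "\<C> \<noteq> {}" "subset.chain ?A \<C>"
    then have sub: "\<And>H. H \<in> \<C> \<Longrightarrow> H \<in> ?A" by (auto simp: subset_chain_def)
    have "topspace S \<inter> \<Inter>\<F> \<noteq> {}" if \<F>: "finite \<F>" "\<F> \<subseteq> \<Union>\<C>" for \<F>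
    proof -
      obtain H where "H \<in> \<C>" "\<F> \<subseteq> H" using finite_subset_Union_chain[OF \<F> \<C>] by metis
      then show ?thesis using sub[of H] \<F>(1) by blast
    qed
    moreover have "G \<subseteq> \<Union>\<C>" using \<C>(1) sub by blast
    moreover have "\<Union>\<C> \<subseteq> \<BB>" using sub by blast
    ultimately show "\<Union>\<C> \<in> ?A" by blast
  qed
  then obtain s where s: "G \<subseteq> s" "s \<subseteq> \<BB>" "?fip s"
    and max: "\<And>H. s \<subseteq> H \<Longrightarrow> H \<subseteq> \<BB> \<Longrightarrow> ?fip H \<Longrightarrow> H = s"
    by (smt (verit, best) mem_Collect_eq subset_trans)
  \<comment> \<open>Maximality in contrapositive form: otherwise \<open>insert B s\<close> would
    still have the finite intersection property.\<close>
  have avoid_mem: "\<exists>\<F>. finite \<F> \<and> \<F> \<subseteq> s \<and> topspace S \<inter> \<Inter>\<F> \<inter> B = {}" if B: "B \<in> \<BB>" "B \<notin> s" for B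
  proof (rule ccontr)
    assume neg: "\<not> ?thesis"
    have "?fip (insert B s)"
    proof (intro allI impI notI)
      fix \<F> assume "finite \<F>" "\<F> \<subseteq> insert B s" "topspace S \<inter> \<Inter>\<F> = {}"
      then have "finite (\<F> - {B})" "\<F> - {B} \<subseteq> s" "topspace S \<inter> \<Inter>(\<F> - {B}) \<inter> B = {}" by blast+
      with neg show False by blast
    qed
    then have "insert B s = s" using s B by (intro max) auto
    with B show False by blast
  qed
  \<comment> \<open>If both were missing, two finite intersections, one avoiding \<open>B\<close>
    and one avoiding its complement, would combine into an open set avoiding both. Such a set is
    empty.\<close>
  have dich: "B \<in> s \<or> reg_compl S B \<in> s" if B: "B \<in> \<BB>" for B
  proof (rule ccontr)
    assume "\<not> ?thesis"
    then obtain \<F>1 \<F>2 where \<F>: "finite \<F>1" "\<F>1 \<subseteq> s" "topspace S \<inter> \<Inter>\<F>1 \<inter> B = {}"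
        "finite \<F>2" "\<F>2 \<subseteq> s" "topspace S \<inter> \<Inter>\<F>2 \<inter> reg_compl S B = {}"
      using avoid_mem B compl_mem by metis
    let ?I = "topspace S \<inter> \<Inter>(\<F>1 \<union> \<F>2)"
    have "?I \<in> \<BB>" using \<F> s by (intro Inter_mem) auto
    moreover have "?I \<inter> B = {}" "?I \<inter> reg_compl S B = {}" using \<F>(3,6) by blast+
    ultimately have "?I = {}" using open_mem open_meets_reg_compl by metis
    moreover have "?I \<noteq> {}" using s(3) \<F> by (metis finite_UnI le_sup_iff)
    ultimately show False by blast
  qed
  \<comment> \<open>Three members suffice for both closure properties: if the candidate were
    missing, \<open>dich\<close> would supply its complement as the third set.\<close>
  have no: "False" if "A \<in> s" "B \<in> s" "C \<in> s" "A \<inter> B \<inter> C = {}" for A B C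
  proof -
    have "topspace S \<inter> \<Inter>{A, B, C} \<noteq> {}"
      using that by (intro s(3)[rule_format]) auto
    with that(4) show False by auto
  qed
  have "ultra s" unfolding reg_ultrafilter_def
  proof (intro conjI ballI impI)
    show "s \<subseteq> \<BB>" by (rule s)
    show "{} \<notin> s" using no[of "{}" "{}" "{}"] by blast
    show "topspace S \<in> s"
      using dich[OF topspace_mem] no[of "{}" "{}" "{}"] by (auto simp: reg_compl_eq)
    show "B \<in> s \<or> reg_compl S B \<in> s" if "B \<in> \<BB>" for B by (rule dich[OF that])
    show "A \<inter> B \<in> s" if "A \<in> s" "B \<in> s" for A B
      using dich[of "A \<inter> B"] no[OF that, of "reg_compl S (A \<inter> B)"] that s(2) Int_mem
      by (auto simp: reg_compl_disjoint)
    show "B \<in> s" if "A \<in> s" "B \<in> \<BB>" "A \<subseteq> B" for A B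
      using dich[OF that(2)] no[OF that(1,1), of "reg_compl S B"] that reg_compl_disjoint[of B S] by blast
  qed
  with s(1) show ?thesis by (rule that[rotated])
qed

section \<open>The representation of the algebra by sets of ultrafilters\<close>

lemma star_Int: "A \<in> \<BB> \<Longrightarrow> B \<in> \<BB> \<Longrightarrow> star (A \<inter> B) = star A \<inter> star B"
  by (auto simp: star_set_def intro: ultra_Int ultra_mono)

lemma star_topspace: "star (topspace S) = {s. ultra s}"
  by (auto simp: star_set_def ultra_topspace)

lemma star_empty: "star {} = {}"
  by (auto simp: star_set_def ultra_empty)

lemma star_compl: "B \<in> \<BB> \<Longrightarrow> star (reg_compl S B) = star (topspace S) - star B"
  by (auto simp: star_topspace) (auto simp: star_set_def ultra_compl_iff)

text \<open>An ultrafilter containing the join but neither \<open>A\<close> nor \<open>B\<close>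
  would contain both complements, whose intersection is open and misses the join.\<close>

lemma star_join:
  assumes "A \<in> \<BB>" "B \<in> \<BB>"
  shows "star (reg_join S {A, B}) = star A \<union> star B"
proof -
  let ?J = "reg_join S {A, B}"
  have J: "A \<union> B \<subseteq> ?J" using subset_reg_join[of "{A, B}" S] assms open_mem by auto
  have "reg_compl S A \<inter> reg_compl S B \<inter> ?J = {}"
    using assms reg_compl_disjoint[of A S] reg_compl_disjoint[of B S]
    by (intro open_meets_reg_join openin_Int open_mem compl_mem) auto
  then have "A \<in> s \<or> B \<in> s" if "ultra s" "?J \<in> s" for s
    using that assms ultra_compl_iff[OF that(1)] ultra_Int[OF that(1)] ultra_empty[OF that(1)] by metis
  then show ?thesis
    using J assms join_mem[OF assms] by (auto simp: star_set_def intro: ultra_mono)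
qed

text \<open>For nonempty \<open>B\<close> the family \<open>{B}\<close> has the finite intersection
  property, so it extends to an ultrafilter. Faithfulness of the representation rests on
  this.\<close>

lemma star_nonempty:
  assumes "B \<in> \<BB>" "B \<noteq> {}"
  shows "star B \<noteq> {}"
proof -
  obtain s where "ultra s" "{B} \<subseteq> s"
  proof (rule ultrafilter_extension[of "{B}"])
    show "topspace S \<inter> \<Inter>\<F> \<noteq> {}" if "\<F> \<subseteq> {B}" for \<F>
      using that assms mem_subset[OF assms(1)] by (cases "\<F> = {}") (auto simp: subset_singleton_iff)
  qed (use assms in auto)
  then show ?thesis by (auto simp: star_set_def)
qed

text \<open>Regularity of \<open>B\<close> is used for the forward direction: disjointness of
  \<open>A\<close> from the complement of \<open>B\<close> only puts \<open>A\<close> inside the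
  double complement, which equals \<open>B\<close> for regular open \<open>B\<close>.\<close>

lemma star_subset_iff:
  assumes "A \<in> \<BB>" "B \<in> \<BB>"
  shows "star A \<subseteq> star B \<longleftrightarrow> A \<subseteq> B"
proof
  assume "star A \<subseteq> star B"
  then have "star (A \<inter> reg_compl S B) = {}"
    using assms by (auto simp: star_Int star_compl compl_mem)
  then have "A \<inter> reg_compl S B = {}"
    using star_nonempty assms Int_mem compl_mem by blast
  then have "A \<subseteq> reg_compl S (reg_compl S B)"
    using assms open_mem by (intro reg_compl_maximal) auto
  then show "A \<subseteq> B" by (simp add: reg_compl_reg_compl regular assms)
qed (use assms in \<open>auto simp: star_set_def intro: ultra_mono\<close>)

lemma star_inj: "A \<in> \<BB> \<Longrightarrow> B \<in> \<BB> \<Longrightarrow> star A = star B \<longleftrightarrow> A = B"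
  using star_subset_iff by (metis subset_antisym order_refl)

section \<open>The topology of the Stone space\<close>

lemma topspace_stone: "topspace stone = star (topspace S)"
proof -
  have "star B \<subseteq> star (topspace S)" for B by (auto simp: star_topspace) (auto simp: star_set_def)
  then show ?thesis
    using topspace_mem by (auto simp: stone_space_def topology_generated_by_topspace)
qed

lemma star_Clp:
  assumes "B \<in> \<BB>"
  shows "star B \<in> Clp stone"
proof -
  have op: "openin stone (star C)" if "C \<in> \<BB>" for C
    using that by (auto simp: stone_space_def intro: topology_generated_by_Basis)
  have "star B \<subseteq> topspace stone" unfolding topspace_stone star_topspace by (auto simp: star_set_def)
  then show ?thesis
    using op[OF assms] op[OF compl_mem[OF assms]] assms
    by (simp add: Clp_def closedin_def star_compl topspace_stone)
qed

text \<open>The sets \<open>star B\<close> are introduced as a subbase; since \<open>star\<close>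
  preserves intersections they form a base, by induction on the generation of the open set.\<close>

lemma stone_base:
  assumes "openin stone U" "s \<in> U"
  shows "\<exists>B\<in>\<BB>. s \<in> star B \<and> star B \<subseteq> U"
proof -
  have "generate_topology_on (star ` \<BB>) U"
    using assms(1) by (simp add: stone_space_def openin_topology_generated_by_iff)
  then show ?thesis using assms(2)
  proof (induction arbitrary: s)
    case (Int U V)
    then obtain A B where "A \<in> \<BB>" "s \<in> star A" "star A \<subseteq> U" "B \<in> \<BB>" "s \<in> star B" "star B \<subseteq> V"
      by (metis IntE)
    then show ?case by (intro bexI[of _ "A \<inter> B"]) (auto simp: star_Int Int_mem)
  next
    case (UN K) then show ?case by (meson Union_iff Sup_upper subset_trans)
  qed auto
qed

text \<open>Consider the complements of those \<open>A\<close> whose \<open>star A\<close> lies in a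
  member of the cover. Were all their finite intersections nonempty, some ultrafilter would contain
  all of them, yet a basic set around it lies in a member of the cover. So finitely many complements
  have empty intersection, which means that every ultrafilter contains one of the corresponding
  \<open>A\<close>.\<close>

lemma compact_stone: "compact_space stone"
  unfolding compact_space_alt
proof (intro allI impI)
  fix \<U> assume \<U>: "(\<forall>U\<in>\<U>. openin stone U) \<and> topspace stone \<subseteq> \<Union>\<U>"
  let ?\<A> = "{A \<in> \<BB>. \<exists>U\<in>\<U>. star A \<subseteq> U}"
  let ?G = "reg_compl S ` ?\<A>"
  have "\<exists>\<F>. finite \<F> \<and> \<F> \<subseteq> ?G \<and> topspace S \<inter> \<Inter>\<F> = {}"
  proof (rule ccontr)
    assume neg: "\<not> ?thesis"
    obtain s where s: "ultra s" "?G \<subseteq> s"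
      by (rule ultrafilter_extension[of ?G]) (use neg compl_mem in auto)
    then have "s \<in> \<Union>\<U>" using \<U> by (auto simp: topspace_stone star_topspace)
    then obtain U where U: "U \<in> \<U>" "s \<in> U" by blast
    then obtain B where B: "B \<in> \<BB>" "s \<in> star B" "star B \<subseteq> U" using stone_base[of U s] \<U> by blast
    then have "reg_compl S B \<in> s" using s U by blast
    then show False using B s by (simp add: ultra_compl_iff) (simp add: star_set_def)
  qed
  then obtain \<F> where \<F>: "finite \<F>" "\<F> \<subseteq> ?G" "topspace S \<inter> \<Inter>\<F> = {}" by blast
  obtain \<A> where "\<A> \<subseteq> ?\<A>" "finite \<A>" "\<F> = reg_compl S ` \<A>"
    using finite_subset_image[OF \<F>(1,2)] by blast
  with \<F>(3) have \<A>: "finite \<A>" "\<A> \<subseteq> ?\<A>" "topspace S \<inter> \<Inter>(reg_compl S ` \<A>) = {}"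
    by simp_all
  then have "\<forall>A\<in>\<A>. \<exists>U. U \<in> \<U> \<and> star A \<subseteq> U" by blast
  then obtain u where u: "\<And>A. A \<in> \<A> \<Longrightarrow> u A \<in> \<U> \<and> star A \<subseteq> u A" unfolding bchoice_iff by blast
  have "topspace stone \<subseteq> \<Union>(u ` \<A>)"
  proof
    fix s assume "s \<in> topspace stone"
    then have s: "ultra s" by (simp add: topspace_stone star_topspace)
    have "\<exists>A\<in>\<A>. A \<in> s"
    proof (rule ccontr)
      assume "\<not> ?thesis"
      then have "reg_compl S ` \<A> \<subseteq> s" using \<A>(2) s by (auto simp: ultra_compl_iff)
      then have "topspace S \<inter> (\<Inter>A\<in>\<A>. reg_compl S A) \<in> s" using \<A>(1) s by (intro ultra_Inter) auto
      then show False using \<A>(3) ultra_empty[OF s] by simp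
    qed
    then obtain A where "A \<in> \<A>" "s \<in> star A" using s by (auto simp: star_set_def)
    then show "s \<in> \<Union>(u ` \<A>)" using u by blast
  qed
  then show "\<exists>\<F>. finite \<F> \<and> \<F> \<subseteq> \<U> \<and> topspace stone \<subseteq> \<Union>\<F>"
    using \<A>(1) u by (intro exI[of _ "u ` \<A>"]) auto
qed

text \<open>An inclusion \<open>s \<subseteq> t\<close> of ultrafilters is an equality, because
  \<open>B \<in> t - s\<close> would put the complement of \<open>B\<close> into \<open>s\<close>
  and hence into \<open>t\<close>. Distinct ultrafilters are therefore separated by some
  \<open>B\<close> and its complement.\<close>

lemma Hausdorff_stone: "Hausdorff_space stone"
  unfolding Hausdorff_space_def
proof (intro allI impI)
  fix s t assume st: "s \<in> topspace stone \<and> t \<in> topspace stone \<and> s \<noteq> t"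
  then have u: "ultra s" "ultra t" by (auto simp: topspace_stone star_topspace)
  have "\<exists>B\<in>\<BB>. s \<in> star B \<and> t \<notin> star B"
  proof (rule ccontr)
    assume "\<not> ?thesis"
    then have "s \<subseteq> t" using u ultra_subset[OF u(1)] by (auto simp: star_set_def)
    moreover have "t \<subseteq> s"
    proof
      fix B assume B: "B \<in> t"
      show "B \<in> s"
        using ultra_compl_iff[OF u(1), of B] ultra_compl_iff[OF u(2), of B] ultra_subset[OF u(2)] B \<open>s \<subseteq> t\<close>
        by blast
    qed
    ultimately show False using st by blast
  qed
  then obtain B where B: "B \<in> \<BB>" "s \<in> star B" "t \<notin> star B" by blast
  have "openin stone (star B)" "openin stone (star (reg_compl S B))"
    using star_Clp[OF B(1)] star_Clp[OF compl_mem[OF B(1)]] by (auto simp: Clp_def)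
  moreover have "t \<in> star (reg_compl S B)" using B u by (simp add: star_compl star_topspace)
  ultimately show "\<exists>U V. openin stone U \<and> openin stone V \<and> s \<in> U \<and> t \<in> V \<and> disjnt U V"
    using B by (intro exI[of _ "star B"] exI[of _ "star (reg_compl S B)"]) (auto simp: star_compl disjnt_def)
qed

lemma star_finite_Union:
  "finite \<F> \<Longrightarrow> \<F> \<subseteq> star ` \<BB> \<Longrightarrow> \<Union>\<F> \<in> star ` \<BB>"
proof (induction rule: finite_induct)
  case empty show ?case using star_empty empty_mem by force
next
  case (insert C \<F>)
  then obtain A B where "A \<in> \<BB>" "B \<in> \<BB>" "C = star A" "\<Union>\<F> = star B" by auto
  then have "\<Union>(insert C \<F>) = star (reg_join S {A, B})" "reg_join S {A, B} \<in> \<BB>"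
    by (auto simp: star_join join_mem)
  then show ?case by (metis imageI)
qed

text \<open>A clopen set is a union of basic sets and is compact, so finitely many suffice; joins in
  the algebra merge them into one.\<close>

lemma Clp_stone: "Clp stone = star ` \<BB>"
proof
  show "star ` \<BB> \<subseteq> Clp stone" using star_Clp by blast
  show "Clp stone \<subseteq> star ` \<BB>"
  proof
    fix C assume C: "C \<in> Clp stone"
    let ?\<U> = "{star B |B. B \<in> \<BB> \<and> star B \<subseteq> C}"
    have "compactin stone C"
      using C compact_stone by (auto simp: Clp_def closedin_compact_space)
    moreover have "C \<subseteq> \<Union>?\<U>"
    proof
      fix s assume "s \<in> C"
      then obtain B where "B \<in> \<BB>" "s \<in> star B" "star B \<subseteq> C"
        using stone_base[of C s] C by (auto simp: Clp_def)
      then show "s \<in> \<Union>?\<U>" by blast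
    qed
    moreover have "openin stone U" if "U \<in> ?\<U>" for U
      using that star_Clp by (auto simp: Clp_def)
    ultimately obtain \<F> where "finite \<F>" "\<F> \<subseteq> ?\<U>" "C \<subseteq> \<Union>\<F>" using compactinD by meson
    then have "finite \<F>" "\<F> \<subseteq> star ` \<BB>" "\<Union>\<F> = C" by blast+
    then show "C \<in> star ` \<BB>" using star_finite_Union by blast
  qed
qed

section \<open>The charge on the Stone space\<close>

lemma star_charge_star: "B \<in> \<BB> \<Longrightarrow> star_charge S \<BB> \<mu> (star B) = \<mu> B"
proof -
  assume B: "B \<in> \<BB>"
  have "(THE A. A \<in> \<BB> \<and> star A = star B) = B"
    using B by (intro the_equality) (auto simp: star_inj)
  then show ?thesis by (simp add: star_charge_def)
qed

lemma content_join:
  assumes "reg_content S \<BB> \<mu>" "A \<in> \<BB>" "B \<in> \<BB>" "A \<inter> B = {}"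
  shows "\<mu> (reg_join S {A, B}) = \<mu> A + \<mu> B"
proof -
  let ?f = "\<lambda>n::nat. if n = 0 then A else B"
  have "\<forall>n<2. ?f n \<in> \<BB>" using assms by auto
  moreover have "disjoint_family_on ?f {..<2}" using assms(4) by (auto simp: disjoint_family_on_def)
  ultimately have "\<mu> (reg_join S (?f ` {..<2})) = (\<Sum>n<2. \<mu> (?f n))"
    using assms(1) by (simp only: reg_content_def)
  moreover have "?f ` {..<2} = {A, B}" by (simp add: lessThan_Suc numeral_2_eq_2 insert_commute)
  ultimately show ?thesis by (simp add: numeral_2_eq_2)
qed

lemma clopen_charge_stone:
  assumes "reg_content S \<BB> \<mu>"
  shows "clopen_charge stone (star_charge S \<BB> \<mu>)"
proof
  show "compact_space stone" "Hausdorff_space stone" by (rule compact_stone Hausdorff_stone)+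
  show "\<exists>C\<in>Clp stone. s \<in> C \<and> C \<subseteq> U" if "openin stone U" "s \<in> U" for U s
    using stone_base[OF that] by (auto simp: Clp_stone)
  show "0 \<le> star_charge S \<BB> \<mu> C" if "C \<in> Clp stone" for C
    using that assms by (auto simp: Clp_stone star_charge_star reg_content_def)
  show "star_charge S \<BB> \<mu> (topspace stone) = 1"
    using assms by (simp add: topspace_stone star_charge_star topspace_mem reg_content_def)
  fix C D assume "C \<in> Clp stone" "D \<in> Clp stone" and disj: "C \<inter> D = {}"
  then obtain A B where AB: "A \<in> \<BB>" "B \<in> \<BB>" "C = star A" "D = star B" by (auto simp: Clp_stone)
  then have "A \<inter> B = {}" using disj star_nonempty[of "A \<inter> B"] by (auto simp: star_Int Int_mem)
  then have "star_charge S \<BB> \<mu> (star (reg_join S {A, B})) = \<mu> A + \<mu> B"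
    using AB assms by (simp add: star_charge_star join_mem content_join)
  then show "star_charge S \<BB> \<mu> (C \<union> D) = star_charge S \<BB> \<mu> C + star_charge S \<BB> \<mu> D"
    using AB by (simp add: star_join star_charge_star)
qed

end

section \<open>Regular open sets of a dense subspace\<close>

lemma regular_open_interior_of_closure_of: "regular_open X (X interior_of (X closure_of A))"
proof -
  have "X closure_of (X interior_of (X closure_of A)) \<subseteq> X closure_of A"
    using closure_of_mono[OF interior_of_subset] by (metis closure_of_closure_of)
  then have "X interior_of (X closure_of (X interior_of (X closure_of A))) \<subseteq> X interior_of (X closure_of A)"
    by (rule interior_of_mono)
  moreover have "X interior_of (X closure_of A) \<subseteq> X interior_of (X closure_of (X interior_of (X closure_of A)))"
    by (intro interior_of_maximal closure_of_subset interior_of_subset_topspace) auto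
  ultimately show ?thesis by (simp add: regular_open_def)
qed

lemma closure_of_open_dense:
  assumes "Z closure_of E = topspace Z" "openin Z Q"
  shows "Z closure_of (Q \<inter> E) = Z closure_of Q"
  using assms openin_subset by (metis closure_of_openin_Int_superset)

text \<open>A regular open set is determined by its closure, and the closure of an open set by its
  trace on a dense subspace; this forces the formula. Conversely, the trace of the set given by the
  formula lies between \<open>R\<close> and the interior of the closure of \<open>R\<close>, which
  coincide. The equivalence thus yields existence and uniqueness for the description in
  \<open>sc_hat\<close>.\<close>

lemma regular_open_dense_extension:
  assumes emb: "embedding_map X Z e" and dense: "Z closure_of (e ` topspace X) = topspace Z"
    and R: "regular_open X R"
  shows "regular_open Z Q \<and> {x \<in> topspace X. e x \<in> Q} = R \<longleftrightarrow>
    Q = Z interior_of (Z closure_of (e ` R))"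
proof -
  let ?E = "e ` topspace X" and ?Q = "Z interior_of (Z closure_of (e ` R))"
  have hom: "homeomorphic_map X (subtopology Z ?E) e" using emb by (simp add: embedding_map_def)
  then have inj: "inj_on e (topspace X)" by (simp add: homeomorphic_eq_everything_map)
  have cont: "continuous_map X Z e"
    using hom by (auto simp: homeomorphic_eq_everything_map continuous_map_in_subtopology)
  have open_image: "\<exists>W. openin Z W \<and> e ` V = W \<inter> ?E" if "openin X V" for V
  proof -
    have "openin (subtopology Z ?E) (e ` V)"
      by (rule iffD2[OF homeomorphic_map_openness[OF hom openin_subset[OF that]] that])
    then show ?thesis by (simp only: openin_subtopology)
  qed
  have Rsub: "openin X R" "R \<subseteq> topspace X" using R openin_subset by (auto simp: regular_open_def)
  show ?thesis
  proof
    assume Q: "regular_open Z Q \<and> {x \<in> topspace X. e x \<in> Q} = R"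
    then have "e ` R = Q \<inter> ?E" by auto
    then have "Z closure_of (e ` R) = Z closure_of Q"
      using closure_of_open_dense[OF dense] Q by (simp add: regular_open_def)
    then show "Q = ?Q" using Q by (simp add: regular_open_def)
  next
    obtain W where W: "openin Z W" "e ` R = W \<inter> ?E" using open_image[OF Rsub(1)] by blast
    have "W \<subseteq> ?Q"
      unfolding W(2) closure_of_open_dense[OF dense W(1)]
      using W(1) openin_subset by (intro interior_of_maximal closure_of_subset) auto
    then have "R \<subseteq> {x \<in> topspace X. e x \<in> ?Q}" using W(2) Rsub by blast
    moreover have "{x \<in> topspace X. e x \<in> ?Q} \<subseteq> X interior_of (X closure_of R)"
    proof (rule interior_of_maximal)
      show "openin X {x \<in> topspace X. e x \<in> ?Q}"
        by (rule openin_continuous_map_preimage[OF cont]) simp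
      show "{x \<in> topspace X. e x \<in> ?Q} \<subseteq> X closure_of R"
      proof (clarsimp simp: in_closure_of)
        fix y V assume y: "y \<in> topspace X" "e y \<in> ?Q" and V: "y \<in> V" "openin X V"
        obtain W' where W': "openin Z W'" "e ` V = W' \<inter> ?E" using open_image[OF V(2)] by blast
        have "e y \<in> Z closure_of (e ` R)" by (rule subsetD[OF interior_of_subset y(2)])
        moreover have "e y \<in> W'" using W' V(1) by blast
        ultimately obtain r where r: "r \<in> R" "e r \<in> W'" using W'(1) unfolding in_closure_of by blast
        then have "e r \<in> e ` V" using W' Rsub by blast
        then have "r \<in> V"
          using inj r Rsub openin_subset[OF V(2)] by (auto dest!: inj_onD)
        with r show "\<exists>r. r \<in> R \<and> r \<in> V" by blast
      qed
    qed
    moreover have "X interior_of (X closure_of R) = R" using R by (simp add: regular_open_def)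
    ultimately show "regular_open Z Q \<and> {x \<in> topspace X. e x \<in> Q} = R" if "Q = ?Q"
      using that by (auto simp: regular_open_interior_of_closure_of)
  qed
qed

lemma sc_hat_eq:
  assumes "completely_regular_space X" "Hausdorff_space X" "regular_open X R"
  shows "sc_hat X R = stone_cech X interior_of (stone_cech X closure_of (sc_emb X ` R))"
  unfolding sc_hat_def
  using regular_open_dense_extension[OF embedding_map_sc_emb[OF assms(1,2)] stone_cech_dense assms(3)]
  by simp

lemma
  assumes "completely_regular_space X" "Hausdorff_space X" "regular_open X R"
  shows regular_open_sc_hat: "regular_open (stone_cech X) (sc_hat X R)"
    and sc_emb_in_sc_hat: "x \<in> topspace X \<Longrightarrow> sc_emb X x \<in> sc_hat X R \<longleftrightarrow> x \<in> R"
    and closure_of_sc_hat: "stone_cech X closure_of sc_hat X R = stone_cech X closure_of (sc_emb X ` R)"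
proof -
  let ?Z = "stone_cech X" and ?Q = "sc_hat X R"
  have *: "regular_open ?Z ?Q" "{x \<in> topspace X. sc_emb X x \<in> ?Q} = R"
    using regular_open_dense_extension[OF embedding_map_sc_emb[OF assms(1,2)] stone_cech_dense assms(3)]
      sc_hat_eq[OF assms] by blast+
  show "regular_open ?Z ?Q" by (rule *)
  show "x \<in> topspace X \<Longrightarrow> sc_emb X x \<in> ?Q \<longleftrightarrow> x \<in> R" using *(2) by blast
  have "sc_emb X ` R = ?Q \<inter> sc_emb X ` topspace X" using *(2) by blast
  then show "?Z closure_of ?Q = ?Z closure_of (sc_emb X ` R)"
    using closure_of_open_dense[OF stone_cech_dense, of X ?Q] *(1) by (simp add: regular_open_def)
qed

text \<open>Inside the product the extension is evaluation at the coordinate \<open>g\<close>. It is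
  the only one, since continuous real functions that agree on the dense image agree
  everywhere.\<close>

lemma sc_ext_eq:
  assumes g: "g \<in> bcont X" and z: "z \<in> topspace (stone_cech X)"
  shows "sc_ext X g z = z g"
proof -
  let ?Z = "stone_cech X"
  let ?h = "restrict (\<lambda>y. y g) (topspace ?Z)"
  have h: "continuous_map ?Z euclideanreal ?h"
    using stone_cech_extension(1)[OF g] by (rule continuous_map_eq) auto
  have hx: "?h (sc_emb X x) = g x" if "x \<in> topspace X" for x
    using that sc_emb_in[of X] stone_cech_extension(2)[OF g that] by auto
  have "sc_ext X g = ?h" unfolding sc_ext_def
  proof (rule the_equality)
    show "?h \<in> extensional (topspace ?Z) \<and> continuous_map ?Z euclideanreal ?h \<and>
        (\<forall>x\<in>topspace X. ?h (sc_emb X x) = g x)"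
      using h hx by auto
    fix k assume k: "k \<in> extensional (topspace ?Z) \<and> continuous_map ?Z euclideanreal k \<and>
        (\<forall>x\<in>topspace X. k (sc_emb X x) = g x)"
    have "k y = ?h y" if "y \<in> topspace ?Z" for y
    proof (rule forall_in_closure_of_eq[where f = k and g = ?h and Y = euclideanreal])
      show "y \<in> ?Z closure_of (sc_emb X ` topspace X)" using that by (simp add: stone_cech_dense)
      show "k w = ?h w" if "w \<in> sc_emb X ` topspace X" for w
        using that k hx by (metis imageE)
    qed (use h k in auto)
    then show "k = ?h" using k by (intro extensionalityI[of _ "topspace ?Z"]) auto
  qed
  with z show ?thesis by simp
qed

section \<open>The map from the Stone space to the Stone-Cech compactification\<close>

locale generative_algebra = reg_algebra +
  assumes complreg: "completely_regular_space S" and Hausdorff_base: "Hausdorff_space S"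
    and generative: "generative S \<BB>"
begin

abbreviation "SC \<equiv> stone_cech S"

lemma hat_base:
  assumes "openin SC U" "z \<in> U"
  obtains B where "B \<in> \<BB>" "z \<in> sc_hat S B" "sc_hat S B \<subseteq> U"
proof -
  have "(arbitrary union_of (\<lambda>U. U \<in> sc_hat S ` \<BB>)) U"
    using generative assms(1) by (simp add: generative_def)
  then obtain \<U> where "\<U> \<subseteq> sc_hat S ` \<BB>" "\<Union>\<U> = U" by (auto simp: union_of_def)
  then show ?thesis using assms(2) that by blast
qed

text \<open>The content is that the intersection of closures is a singleton, so that
  \<open>the_elem\<close> is meaningful. Compactness makes it nonempty. For two points
  \<open>y\<close> and \<open>z\<close>, generativity gives \<open>B\<close> whose hat contains
  \<open>y\<close> and avoids a neighbourhood of \<open>z\<close>. If \<open>B \<in> s\<close> then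
  \<open>z\<close> lies in the closure of that hat, which is impossible; otherwise \<open>y\<close>
  lies in the closure of the complement of \<open>B\<close>, although the hat is an open
  neighbourhood of \<open>y\<close> that misses this complement.\<close>

lemma stone_proj_in_closure:
  assumes s: "ultra s" and A: "A \<in> s"
  shows "stone_proj S s \<in> SC closure_of (sc_emb S ` A)"
proof -
  let ?K = "\<lambda>B. SC closure_of (sc_emb S ` B)"
  have cl: "SC closure_of sc_hat S B = ?K B" if "B \<in> s" for B
    using that ultra_subset[OF s] by (intro closure_of_sc_hat complreg Hausdorff_base regular) auto
  have "(\<Inter>B\<in>s. ?K B) \<noteq> {}"
  proof (rule compact_stone_cech[unfolded compact_space_fip, rule_format], intro conjI allI impI ballI)
    show "closedin SC C" if "C \<in> ?K ` s" for C using that by auto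
    fix \<F> assume "finite \<F> \<and> \<F> \<subseteq> ?K ` s"
    then obtain \<A> where \<A>: "finite \<A>" "\<A> \<subseteq> s" "\<F> = ?K ` \<A>"
      using finite_subset_image[of \<F> ?K s] by blast
    let ?I = "topspace S \<inter> \<Inter>\<A>"
    have "?I \<noteq> {}" using ultra_Inter[OF \<A>(1,2) s] ultra_empty[OF s] by metis
    then obtain x where x: "x \<in> topspace S" "\<And>B. B \<in> \<A> \<Longrightarrow> x \<in> B" by blast
    have "sc_emb S x \<in> ?K B" if "B \<in> \<A>" for B
    proof -
      have "sc_emb S ` B \<subseteq> topspace SC"
        using sc_emb_in[of S] mem_subset ultra_subset[OF s] \<A>(2) that by blast
      then show ?thesis using closure_of_subset x that by blast
    qed
    then show "\<Inter>\<F> \<noteq> {}" using \<A>(3) by blast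
  qed
  then obtain z where z: "z \<in> (\<Inter>B\<in>s. ?K B)" by blast
  have "y = z" if y: "y \<in> (\<Inter>B\<in>s. ?K B)" for y
  proof (rule ccontr)
    assume "y \<noteq> z"
    moreover have "y \<in> topspace SC" "z \<in> topspace SC"
      using y z A closure_of_subset_topspace by (metis INT_iff subsetD)+
    ultimately obtain U V where UV: "openin SC U" "openin SC V" "y \<in> U" "z \<in> V" "disjnt U V"
      using Hausdorff_stone_cech[of S] unfolding Hausdorff_space_def by metis
    then obtain B where B: "B \<in> \<BB>" "y \<in> sc_hat S B" "sc_hat S B \<subseteq> U" using hat_base by metis
    consider "B \<in> s" | "reg_compl S B \<in> s" using ultra_dichotomy[OF s B(1)] by blast
    then show False
    proof cases
      case 1
      then have "z \<in> SC closure_of sc_hat S B" using z cl by blast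
      then obtain w where "w \<in> sc_hat S B" "w \<in> V" using UV unfolding in_closure_of by blast
      then show False using UV(5) B(3) by (auto simp: disjnt_def)
    next
      case 2
      have "openin SC (sc_hat S B)"
        using regular_open_sc_hat[OF complreg Hausdorff_base regular[OF B(1)]] by (simp add: regular_open_def)
      moreover have "y \<in> ?K (reg_compl S B)" using y 2 by blast
      ultimately obtain x where x: "x \<in> reg_compl S B" "sc_emb S x \<in> sc_hat S B"
        using B(2) unfolding in_closure_of by blast
      then have "x \<in> B"
        using sc_emb_in_sc_hat[OF complreg Hausdorff_base regular[OF B(1)], of x]
          mem_subset[OF compl_mem[OF B(1)]] by blast
      with x(1) show False using reg_compl_disjoint[of B S] by blast
    qed
  qed
  then have "(\<Inter>B\<in>s. ?K B) = {z}" using z by blast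
  then have "stone_proj S s = z"
    unfolding stone_proj_def using cl by simp
  with z A show ?thesis by blast
qed

text \<open>The only properties of \<open>star_fun\<close> needed for integration: on \<open>star B\<close> it satisfies the closed
  conditions that \<open>g\<close> satisfies on \<open>B\<close>.\<close>

lemma star_fun_in_closed:
  assumes g: "g \<in> bcont S" and s: "ultra s" "B \<in> s" and T: "closed T" and gB: "\<And>x. x \<in> B \<Longrightarrow> g x \<in> T"
  shows "star_fun S g s \<in> T"
proof -
  have B: "B \<subseteq> topspace S" using s ultra_subset mem_subset by blast
  have "closedin SC {z \<in> topspace SC. z g \<in> T}"
    using stone_cech_extension(1)[OF g] T by (intro closedin_continuous_map_preimage) auto
  moreover have "sc_emb S ` B \<subseteq> {z \<in> topspace SC. z g \<in> T}"
    using sc_emb_in[of S] B gB stone_cech_extension(2)[OF g] by (auto simp: subset_iff)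
  ultimately have "SC closure_of (sc_emb S ` B) \<subseteq> {z \<in> topspace SC. z g \<in> T}" by (rule closure_of_minimal[rotated])
  then have "stone_proj S s \<in> {z \<in> topspace SC. z g \<in> T}" using stone_proj_in_closure[OF s] by blast
  then show ?thesis by (simp add: star_fun_def sc_ext_eq[OF g])
qed

end

section \<open>Integration against a content\<close>

context reg_algebra
begin

lemma partition_finite: "reg_partition S \<BB> \<P> \<Longrightarrow> finite \<P>"
  and partition_mem: "reg_partition S \<BB> \<P> \<Longrightarrow> P \<in> \<P> \<Longrightarrow> P \<in> \<BB>"
  and partition_disjoint: "reg_partition S \<BB> \<P> \<Longrightarrow> P \<in> \<P> \<Longrightarrow> Q \<in> \<P> \<Longrightarrow> P \<noteq> Q \<Longrightarrow> P \<inter> Q = {}"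
  and partition_dense: "reg_partition S \<BB> \<P> \<Longrightarrow> openin S A \<Longrightarrow> A \<inter> \<Union>\<P> = {} \<Longrightarrow> A = {}"
  by (auto simp: reg_partition_def reg_join_eq_topspace pairwise_def disjnt_def)

text \<open>If every cell were avoided, the finite intersection of the complements would be a
  nonempty open set missing the dense union of the cells. Hence the clopen sets
  \<open>star P\<close> partition the Stone space, although the cells themselves may leave points of
  \<open>S\<close> uncovered.\<close>

lemma ultra_partition:
  assumes s: "ultra s" and \<P>: "reg_partition S \<BB> \<P>"
  shows "\<exists>!P. P \<in> \<P> \<and> P \<in> s"
proof -
  have "\<exists>P\<in>\<P>. P \<in> s"
  proof (rule ccontr)
    assume "\<not> ?thesis"
    then have "reg_compl S ` \<P> \<subseteq> s" using s partition_mem[OF \<P>] by (auto simp: ultra_compl_iff)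
    then have I: "topspace S \<inter> \<Inter>(reg_compl S ` \<P>) \<in> s" (is "?I \<in> s")
      using partition_finite[OF \<P>] s by (intro ultra_Inter) auto
    have "x \<notin> P" if "x \<in> ?I" "P \<in> \<P>" for x P
      using that reg_compl_disjoint[of P S] by blast
    then have "?I \<inter> \<Union>\<P> = {}" by blast
    moreover have "openin S ?I" using I ultra_subset[OF s] by (intro open_mem) auto
    ultimately have "?I = {}" using partition_dense[OF \<P>] by simp
    then show False using I ultra_empty[OF s] by simp
  qed
  moreover have "P = Q" if "P \<in> \<P>" "P \<in> s" "Q \<in> \<P>" "Q \<in> s" for P Q
    using partition_disjoint[OF \<P> that(1,3)] ultra_Int[OF s that(2,4)] ultra_empty[OF s] by metis
  ultimately show ?thesis by blast
qed

text \<open>Density is used twice: first that of the cells of \<open>\<Q>\<close>, applied to the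
  open set \<open>A \<inter> \<Union>\<P>\<close>, then that of the cells of
  \<open>\<P>\<close>.\<close>

lemma partition_refine:
  assumes \<P>: "reg_partition S \<BB> \<P>" and \<Q>: "reg_partition S \<BB> \<Q>"
  shows "reg_partition S \<BB> {P \<inter> Q |P Q. P \<in> \<P> \<and> Q \<in> \<Q>}"
  unfolding reg_partition_def reg_join_eq_topspace
proof (intro conjI allI impI)
  let ?R = "{P \<inter> Q |P Q. P \<in> \<P> \<and> Q \<in> \<Q>}"
  have "?R = (\<lambda>(P, Q). P \<inter> Q) ` (\<P> \<times> \<Q>)" by auto
  then show "finite ?R" using partition_finite[OF \<P>] partition_finite[OF \<Q>] by simp
  show "?R \<subseteq> \<BB>" using partition_mem[OF \<P>] partition_mem[OF \<Q>] Int_mem by auto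
  show "pairwise disjnt ?R"
    using partition_disjoint[OF \<P>] partition_disjoint[OF \<Q>] unfolding pairwise_def disjnt_def by blast
  fix A assume A: "openin S A" "A \<inter> \<Union>?R = {}"
  have "A \<inter> \<Union>\<P> \<inter> \<Union>\<Q> = {}" using A(2) by blast
  moreover have "openin S (A \<inter> \<Union>\<P>)"
    using A(1) partition_mem[OF \<P>] open_mem by (intro openin_Int openin_Union) auto
  ultimately have "A \<inter> \<Union>\<P> = {}" using partition_dense[OF \<Q>] by blast
  then show "A = {}" using partition_dense[OF \<P> A(1)] by blast
qed

lemma partition_topspace: "reg_partition S \<BB> {topspace S}"
  unfolding reg_partition_def reg_join_eq_topspace
  using topspace_mem openin_subset by auto

lemma partition_compl:
  assumes "B \<in> \<BB>"
  shows "reg_partition S \<BB> {B, reg_compl S B}"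
  unfolding reg_partition_def reg_join_eq_topspace
  using assms compl_mem reg_compl_disjoint[of B S] open_meets_reg_compl[of S _ B]
  by (auto simp: pairwise_def disjnt_def Int_Un_distrib)

text \<open>Refining by \<open>{A, reg_compl S A}\<close> for one \<open>A\<close> after another
  leaves each cell inside \<open>A\<close> or inside its complement.\<close>

lemma deciding_partition:
  assumes "finite \<A>" "\<A> \<subseteq> \<BB>"
  shows "\<exists>\<P>. reg_partition S \<BB> \<P> \<and> (\<forall>P\<in>\<P>. \<forall>A\<in>\<A>. P \<subseteq> A \<or> P \<inter> A = {})"
  using assms
proof (induction rule: finite_induct)
  case empty show ?case using partition_topspace by blast
next
  case (insert A \<A>)
  then obtain \<P> where \<P>: "reg_partition S \<BB> \<P>" "\<forall>P\<in>\<P>. \<forall>A\<in>\<A>. P \<subseteq> A \<or> P \<inter> A = {}" by blast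
  have "A \<in> \<BB>" using insert by blast
  let ?\<Q> = "{P \<inter> Q |P Q. P \<in> \<P> \<and> Q \<in> {A, reg_compl S A}}"
  have "reg_partition S \<BB> ?\<Q>" by (intro partition_refine \<P> partition_compl \<open>A \<in> \<BB>\<close>)
  moreover have "P \<subseteq> A' \<or> P \<inter> A' = {}" if "P \<in> ?\<Q>" "A' \<in> insert A \<A>" for P A'
    using that \<P>(2) reg_compl_disjoint[of A S] by blast
  ultimately show ?case by blast
qed

section \<open>Functions of small oscillation on partitions\<close>

text \<open>A form of uniform approximability by simple functions that is easily seen to be stable
  under sums, multiples and uniform limits. Exchanging \<open>x\<close> and \<open>y\<close> gives
  the two-sided bound.\<close>

definition small_oscillation :: "('a \<Rightarrow> real) \<Rightarrow> bool" where
  "small_oscillation g \<longleftrightarrow>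
     (\<forall>\<epsilon>>0. \<exists>\<P>. reg_partition S \<BB> \<P> \<and> (\<forall>P\<in>\<P>. \<forall>x\<in>P. \<forall>y\<in>P. g x - g y \<le> \<epsilon>))"

text \<open>The range is cut at levels \<open>c i\<close> spaced by \<open>\<epsilon>\<close>. A
  larger oscillation on a cell would place some level strictly between two values, and the
  corresponding set \<open>A i\<close> would split the cell.\<close>

lemma small_oscillation_comeas:
  assumes f: "f \<in> comeas S \<BB>"
  shows "small_oscillation f"
  unfolding small_oscillation_def
proof (intro allI impI)
  fix \<epsilon> :: real assume \<epsilon>: "0 < \<epsilon>"
  have cont: "continuous_map S euclideanreal f" and mem: "\<And>r. S interior_of {x \<in> topspace S. f x \<le> r} \<in> \<BB>"
    using f by (auto simp: comeas_def bcont_def)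
  obtain K where K: "\<And>x. x \<in> topspace S \<Longrightarrow> \<bar>f x\<bar> \<le> K"
    using f by (auto simp: comeas_def bcont_def bounded_iff)
  define c where "c i = - K + real i * \<epsilon>" for i
  define A where "A i = S interior_of {x \<in> topspace S. f x \<le> c i}" for i
  \<comment> \<open>Large enough for the index of the first level above any value of
    \<open>f\<close>, including the value \<open>K\<close>.\<close>
  define N where "N = nat \<lceil>2 * K / \<epsilon>\<rceil> + 1"
  obtain \<P> where \<P>: "reg_partition S \<BB> \<P>" "\<forall>P\<in>\<P>. \<forall>B\<in>A ` {..N}. P \<subseteq> B \<or> P \<inter> B = {}"
    using deciding_partition[of "A ` {..N}"] mem by (auto simp: A_def)
  have "f x - f y \<le> \<epsilon>" if P: "P \<in> \<P>" and xy: "x \<in> P" "y \<in> P" for P x y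
  proof (rule ccontr)
    assume gap: "\<not> ?thesis"
    have t: "x \<in> topspace S" "y \<in> topspace S" using P xy mem_subset partition_mem[OF \<P>(1)] by blast+
    \<comment> \<open>The first level above \<open>f y\<close>:
      \<open>c (i - 1) \<le> f y < c i\<close>, so
      \<open>c i \<le> f y + \<epsilon> < f x\<close>.\<close>
    define i where "i = nat \<lfloor>(f y + K) / \<epsilon>\<rfloor> + 1"
    have "0 \<le> (f y + K) / \<epsilon>" using K[OF t(2)] \<epsilon> by simp
    then have i: "real i - 1 \<le> (f y + K) / \<epsilon>" "(f y + K) / \<epsilon> < real i"
      unfolding i_def by linarith+
    have "f y < c i" using i(2) \<epsilon> by (simp add: c_def field_simps)
    moreover have "c i < f x" using i(1) \<epsilon> gap by (simp add: c_def field_simps)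
    moreover have "i \<le> N"
    proof -
      have "(f y + K) / \<epsilon> \<le> 2 * K / \<epsilon>" using K[OF t(2)] \<epsilon> by (intro divide_right_mono) auto
      then show ?thesis unfolding i_def N_def by linarith
    qed
    \<comment> \<open>Since \<open>A i\<close> is an interior, membership of \<open>y\<close> needs
      the strict inequality \<open>f y < c i\<close>, which defines an open set.\<close>
    moreover have "{x \<in> topspace S. f x \<in> {..<c i}} \<subseteq> A i"
      unfolding A_def
      by (intro interior_of_maximal openin_continuous_map_preimage[OF cont]) auto
    moreover have "A i \<subseteq> {x \<in> topspace S. f x \<le> c i}"
      unfolding A_def by (rule interior_of_subset)
    ultimately have "y \<in> A i" "x \<notin> A i" "A i \<in> A ` {..N}" using t by auto
    then show False using \<P>(2) P xy by blast
  qed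
  then show "\<exists>\<P>. reg_partition S \<BB> \<P> \<and> (\<forall>P\<in>\<P>. \<forall>x\<in>P. \<forall>y\<in>P. f x - f y \<le> \<epsilon>)"
    using \<P>(1) by blast
qed

lemma small_oscillation_const: "small_oscillation (\<lambda>x. c)"
  unfolding small_oscillation_def using partition_topspace by auto

lemma small_oscillation_add:
  assumes f: "small_oscillation f" and g: "small_oscillation g"
  shows "small_oscillation (\<lambda>x. f x + g x)"
  unfolding small_oscillation_def
proof (intro allI impI)
  fix \<epsilon> :: real assume "0 < \<epsilon>"
  then have "0 < \<epsilon> / 2" by simp
  then obtain \<P> \<Q> where \<P>: "reg_partition S \<BB> \<P>" "\<forall>P\<in>\<P>. \<forall>x\<in>P. \<forall>y\<in>P. f x - f y \<le> \<epsilon> / 2"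
    and \<Q>: "reg_partition S \<BB> \<Q>" "\<forall>P\<in>\<Q>. \<forall>x\<in>P. \<forall>y\<in>P. g x - g y \<le> \<epsilon> / 2"
    using f g unfolding small_oscillation_def by metis
  have "(f x + g x) - (f y + g y) \<le> \<epsilon>" if "P \<in> \<P>" "Q \<in> \<Q>" "x \<in> P \<inter> Q" "y \<in> P \<inter> Q" for P Q x y
  proof -
    have "f x - f y \<le> \<epsilon> / 2" "g x - g y \<le> \<epsilon> / 2" using that \<P>(2) \<Q>(2) by auto
    then show ?thesis by simp
  qed
  with partition_refine[OF \<P>(1) \<Q>(1)]
  show "\<exists>\<P>. reg_partition S \<BB> \<P> \<and> (\<forall>P\<in>\<P>. \<forall>x\<in>P. \<forall>y\<in>P. (f x + g x) - (f y + g y) \<le> \<epsilon>)"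
    by (intro exI conjI) auto
qed

lemma small_oscillation_cmult:
  assumes f: "small_oscillation f"
  shows "small_oscillation (\<lambda>x. c * f x)"
  unfolding small_oscillation_def
proof (intro allI impI)
  fix \<epsilon> :: real assume \<epsilon>: "0 < \<epsilon>"
  \<comment> \<open>Adding one keeps the divisor positive when \<open>c = 0\<close>.\<close>
  let ?d = "\<epsilon> / (\<bar>c\<bar> + 1)"
  have "0 < ?d" using \<epsilon> by (intro divide_pos_pos) auto
  then obtain \<P> where \<P>: "reg_partition S \<BB> \<P>" "\<forall>P\<in>\<P>. \<forall>x\<in>P. \<forall>y\<in>P. f x - f y \<le> ?d"
    using f unfolding small_oscillation_def by metis
  have "c * f x - c * f y \<le> \<epsilon>" if "P \<in> \<P>" "x \<in> P" "y \<in> P" for P x y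
  proof -
    have "f x - f y \<le> ?d" "f y - f x \<le> ?d" using that \<P>(2) by blast+
    then have "\<bar>c\<bar> * \<bar>f x - f y\<bar> \<le> (\<bar>c\<bar> + 1) * ?d" by (intro mult_mono) auto
    then have "\<bar>c * (f x - f y)\<bar> \<le> \<epsilon>" by (simp add: abs_mult)
    then show ?thesis by (simp add: right_diff_distrib)
  qed
  with \<P>(1) show "\<exists>\<P>. reg_partition S \<BB> \<P> \<and> (\<forall>P\<in>\<P>. \<forall>x\<in>P. \<forall>y\<in>P. c * f x - c * f y \<le> \<epsilon>)" by blast
qed

lemma small_oscillation_sum:
  "finite F \<Longrightarrow> (\<And>f. f \<in> F \<Longrightarrow> small_oscillation (h f)) \<Longrightarrow> small_oscillation (\<lambda>x. \<Sum>f\<in>F. h f x)"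
  by (induction rule: finite_induct) (simp_all add: small_oscillation_const small_oscillation_add)

text \<open>The usual three-term estimate, through a finite linear combination within
  \<open>\<epsilon> / 3\<close> of \<open>g\<close>.\<close>

lemma small_oscillation_comeas_span:
  assumes g: "g \<in> comeas_span S \<BB>"
  shows "small_oscillation g"
  unfolding small_oscillation_def
proof (intro allI impI)
  fix \<epsilon> :: real assume "0 < \<epsilon>"
  then have \<epsilon>: "0 < \<epsilon> / 3" by simp
  then obtain F c where F: "finite F" "F \<subseteq> comeas S \<BB>"
      "\<And>x. x \<in> topspace S \<Longrightarrow> \<bar>g x - (\<Sum>f\<in>F. c f * f x)\<bar> < \<epsilon> / 3"
    using g unfolding comeas_span_def by (smt (verit, ccfv_threshold) mem_Collect_eq)
  let ?h = "\<lambda>x. \<Sum>f\<in>F. c f * f x"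
  have osc: "small_oscillation ?h"
    using F(1,2) by (intro small_oscillation_sum small_oscillation_cmult small_oscillation_comeas) auto
  from osc[unfolded small_oscillation_def, rule_format, OF \<epsilon>]
  obtain \<P> where \<P>: "reg_partition S \<BB> \<P>" "\<forall>P\<in>\<P>. \<forall>x\<in>P. \<forall>y\<in>P. ?h x - ?h y \<le> \<epsilon> / 3"
    by blast
  have "g x - g y \<le> \<epsilon>" if "P \<in> \<P>" "x \<in> P" "y \<in> P" for P x y
  proof -
    have "x \<in> topspace S" "y \<in> topspace S" using that mem_subset partition_mem[OF \<P>(1)] by blast+
    then have "\<bar>g x - ?h x\<bar> < \<epsilon> / 3" "\<bar>g y - ?h y\<bar> < \<epsilon> / 3" using F(3) by blast+
    moreover have "?h x - ?h y \<le> \<epsilon> / 3" using that \<P>(2) by blast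
    ultimately show ?thesis by linarith
  qed
  with \<P>(1) show "\<exists>\<P>. reg_partition S \<BB> \<P> \<and> (\<forall>P\<in>\<P>. \<forall>x\<in>P. \<forall>y\<in>P. g x - g y \<le> \<epsilon>)" by blast
qed

section \<open>Step functions on the Stone space\<close>

text \<open>The counterpart of a simple function. For a partition the sets \<open>star P\<close>
  cover the Stone space, so the arbitrary values off the cells leave no trace here.\<close>

definition step :: "'a set set \<Rightarrow> ('a set \<Rightarrow> real) \<Rightarrow> 'a set set \<Rightarrow> real" where
  "step \<P> r s = (\<Sum>P\<in>\<P>. r P * indicator (star P) s)"

lemma step_eq:
  assumes "reg_partition S \<BB> \<P>" "ultra s" "P \<in> \<P>" "P \<in> s"
  shows "step \<P> r s = r P"
proof -
  have "r Q * indicator (star Q) s = (if Q = P then r P else 0)" if "Q \<in> \<P>" for Q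
    using ultra_partition[OF assms(2,1)] assms that by (auto simp: indicator_def star_set_def)
  then have "step \<P> r s = (\<Sum>Q\<in>\<P>. if Q = P then r P else 0)"
    unfolding step_def by (intro sum.cong) auto
  then show ?thesis using assms partition_finite by simp
qed

end

section \<open>Integration against a Borel extension of the charge\<close>

text \<open>\<open>M\<close> ranges over all Borel extensions, so the integral formula will hold for
  each of them.\<close>

locale charge_measure = reg_algebra +
  fixes \<mu> :: "'a set \<Rightarrow> real" and M :: "'a set set measure"
  assumes borel: "borel_prob stone M"
    and extends: "extends_charge stone (star_charge S \<BB> \<mu>) M"
begin

sublocale prob_space M
  using borel by (simp add: borel_prob_def)

lemma space_M: "space M = {s. ultra s}"
  using borel by (simp add: borel_prob_def topspace_stone star_topspace)

lemma star_measurable [measurable]: "B \<in> \<BB> \<Longrightarrow> star B \<in> sets M"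
  using star_Clp borel_prob_openin[OF borel] by (simp add: Clp_def)

lemma measure_star: "B \<in> \<BB> \<Longrightarrow> measure M (star B) = \<mu> B"
  using extends star_Clp by (simp add: extends_charge_def star_charge_star)

text \<open>Since \<open>star\<close> preserves intersections, the step function cut off to
  \<open>star D\<close> is a combination of indicators of \<open>star (P \<inter> D)\<close>, whose
  measures are \<open>\<mu> (P \<inter> D)\<close>.\<close>

lemma
  assumes \<P>: "reg_partition S \<BB> \<P>" and D: "D \<in> \<BB>"
  shows integrable_step: "set_integrable M (star D) (step \<P> r)"
    and integral_step: "(LINT s:star D|M. step \<P> r s) = (\<Sum>P\<in>\<P>. r P * \<mu> (P \<inter> D))"
proof -
  have PD: "P \<inter> D \<in> \<BB>" if "P \<in> \<P>" for P using Int_mem[OF partition_mem[OF \<P> that] D] .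
  have eq: "(\<lambda>s. indicator (star D) s *\<^sub>R step \<P> r s) = (\<lambda>s. \<Sum>P\<in>\<P>. r P * indicator (star (P \<inter> D)) s)"
    using partition_mem[OF \<P>] D
    by (auto simp: step_def sum_distrib_left star_Int indicator_inter_arith mult_ac intro!: sum.cong ext)
  have int: "integrable M (\<lambda>s. r P * indicator (star (P \<inter> D)) s)" if "P \<in> \<P>" for P
    using star_measurable[OF PD[OF that]]
    by (intro integrable_mult_right integrable_real_indicator) (auto simp: emeasure_eq_measure)
  show "set_integrable M (star D) (step \<P> r)"
    unfolding set_integrable_def eq using int by (rule Bochner_Integration.integrable_sum)
  show "(LINT s:star D|M. step \<P> r s) = (\<Sum>P\<in>\<P>. r P * \<mu> (P \<inter> D))"
    unfolding set_lebesgue_integral_def eq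
    using int star_measurable[OF PD] measure_star[OF PD] sets.sets_into_space[OF star_measurable[OF PD]]
    by (simp add: Bochner_Integration.integral_sum Int_absorb2)
qed

lemma step_measurable [measurable]:
  assumes "reg_partition S \<BB> \<P>"
  shows "step \<P> r \<in> borel_measurable M"
  unfolding step_def using assms partition_mem star_measurable by measurable

text \<open>This also shows that the description in \<open>simple_integral\<close> does not depend
  on the representation. Of two representations, the cells \<open>P\<close> and \<open>Q\<close>
  chosen by an ultrafilter meet, and a common point \<open>x\<close> forces both values to be
  \<open>f x\<close>; hence the step functions coincide.\<close>

lemma simple_integral_eq:
  assumes f: "simple_repr S \<BB> f \<P> r" and D: "D \<in> \<BB>"
  shows "simple_integral S \<BB> \<mu> D f = (LINT s:star D|M. step \<P> r s)"
  unfolding simple_integral_def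
proof (rule the_equality)
  show "\<exists>\<P>' r'. simple_repr S \<BB> f \<P>' r' \<and> (LINT s:star D|M. step \<P> r s) = (\<Sum>P\<in>\<P>'. r' P * \<mu> (P \<inter> D))"
    using f D integral_step by (metis simple_repr_def)
  fix v assume "\<exists>\<Q> q. simple_repr S \<BB> f \<Q> q \<and> v = (\<Sum>P\<in>\<Q>. q P * \<mu> (P \<inter> D))"
  then obtain \<Q> q where \<Q>: "simple_repr S \<BB> f \<Q> q" "v = (\<Sum>P\<in>\<Q>. q P * \<mu> (P \<inter> D))" by blast
  have "step \<Q> q s = step \<P> r s" if s: "ultra s" for s
  proof -
    obtain P where P: "P \<in> \<P>" "P \<in> s"
      using ultra_partition[OF s, of \<P>] f by (auto simp: simple_repr_def)
    obtain Q where Q: "Q \<in> \<Q>" "Q \<in> s"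
      using ultra_partition[OF s, of \<Q>] \<Q>(1) by (auto simp: simple_repr_def)
    have "P \<inter> Q \<noteq> {}" using ultra_Int[OF s P(2) Q(2)] ultra_empty[OF s] by metis
    then obtain x where "x \<in> P" "x \<in> Q" by blast
    then have "f x = r P" "f x = q Q" using f \<Q>(1) P Q unfolding simple_repr_def by blast+
    then show ?thesis using step_eq s P Q f \<Q>(1) by (simp add: simple_repr_def)
  qed
  then have "(LINT s:star D|M. step \<Q> q s) = (LINT s:star D|M. step \<P> r s)"
    unfolding set_lebesgue_integral_def by (intro Bochner_Integration.integral_cong) (auto simp: space_M)
  then show "v = (LINT s:star D|M. step \<P> r s)"
    using integral_step[OF _ D, of \<Q> q] \<Q> by (simp add: simple_repr_def)
qed

end

section \<open>The integral formula\<close>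

locale generative_charge_measure = charge_measure + generative_algebra
begin

lemma star_fun_step_approx:
  assumes g: "g \<in> comeas_span S \<BB>" and \<epsilon>: "0 < \<epsilon>"
  obtains \<P> r where "reg_partition S \<BB> \<P>"
    "\<And>P x. P \<in> \<P> \<Longrightarrow> x \<in> P \<Longrightarrow> r P \<le> g x"
    "\<And>s. ultra s \<Longrightarrow> \<bar>star_fun S g s - step \<P> r s\<bar> \<le> \<epsilon>"
proof -
  have gb: "g \<in> bcont S" using g by (simp add: comeas_span_def)
  have "0 < \<epsilon> / 2" using \<epsilon> by simp
  then obtain \<P> where \<P>: "reg_partition S \<BB> \<P>" "\<And>P x y. P \<in> \<P> \<Longrightarrow> x \<in> P \<Longrightarrow> y \<in> P \<Longrightarrow> g x - g y \<le> \<epsilon> / 2"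
    using small_oscillation_comeas_span[OF g] unfolding small_oscillation_def by metis
  \<comment> \<open>Lowering a sample value by \<open>\<epsilon> / 2\<close> puts \<open>r P\<close>
    below \<open>g\<close> on the whole cell and keeps \<open>g\<close> below
    \<open>r P + \<epsilon>\<close>. On an empty cell the sample point is arbitrary, but the claims
    about its points are vacuous.\<close>
  define r where "r P = g (SOME x. x \<in> P) - \<epsilon> / 2" for P
  have r: "r P \<le> g x" "g x \<le> r P + \<epsilon>" if "P \<in> \<P>" "x \<in> P" for P x
  proof -
    have "(SOME x. x \<in> P) \<in> P" using that(2) by (rule someI)
    then have "g (SOME x. x \<in> P) - g x \<le> \<epsilon> / 2" "g x - g (SOME x. x \<in> P) \<le> \<epsilon> / 2"
      using \<P>(2) that by blast+
    then show "r P \<le> g x" "g x \<le> r P + \<epsilon>" by (simp_all add: r_def)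
  qed
  have "\<bar>star_fun S g s - step \<P> r s\<bar> \<le> \<epsilon>" if s: "ultra s" for s
  proof -
    obtain P where P: "P \<in> \<P>" "P \<in> s" using ultra_partition[OF s \<P>(1)] by blast
    have "star_fun S g s \<in> {r P..r P + \<epsilon>}" using r[OF P(1)] by (intro star_fun_in_closed[OF gb s P(2)]) auto
    then show ?thesis using step_eq[OF \<P>(1) s P] by auto
  qed
  with \<P>(1) r(1) show ?thesis using that by blast
qed

text \<open>Measurability comes from uniform approximation by step functions, with error
  \<open>inverse (real (Suc n))\<close>.\<close>

lemma star_fun_measurable:
  assumes g: "g \<in> comeas_span S \<BB>"
  shows "star_fun S g \<in> borel_measurable M"
proof -
  have "\<exists>\<P> r. reg_partition S \<BB> \<P> \<and> (\<forall>s. ultra s \<longrightarrow> \<bar>star_fun S g s - step \<P> r s\<bar> \<le> inverse (real (Suc n)))" for n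
    using star_fun_step_approx[OF g, of "inverse (real (Suc n))"] 
    by (metis inverse_positive_iff_positive of_nat_0_less_iff zero_less_Suc)
  then obtain \<P> r where *: "\<And>n. reg_partition S \<BB> (\<P> n)"
      "\<And>n s. ultra s \<Longrightarrow> \<bar>star_fun S g s - step (\<P> n) (r n) s\<bar> \<le> inverse (real (Suc n))"
    by metis
  show ?thesis
  proof (rule borel_measurable_LIMSEQ_real)
    show "step (\<P> n) (r n) \<in> borel_measurable M" for n using *(1) by (rule step_measurable)
    fix s assume "s \<in> space M"
    then have "ultra s" by (simp add: space_M)
    then have "norm (step (\<P> n) (r n) s - star_fun S g s) \<le> inverse (real (Suc n))" for n
      using *(2)[of s n] by (simp add: abs_minus_commute)
    then have "(\<lambda>n. step (\<P> n) (r n) s - star_fun S g s) \<longlonglongrightarrow> 0"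
      by (intro Lim_null_comparison[OF _ LIMSEQ_inverse_real_of_nat]) auto
    then show "(\<lambda>n. step (\<P> n) (r n) s) \<longlonglongrightarrow> star_fun S g s" by (simp add: LIM_zero_iff)
  qed
qed

text \<open>Bounds of \<open>g\<close> on the whole space, a member of every ultrafilter, pass to
  \<open>star_fun S g\<close>; a bounded measurable function is integrable for a probability
  measure.\<close>

lemma set_integrable_star_fun:
  assumes g: "g \<in> comeas_span S \<BB>" and D: "D \<in> \<BB>"
  shows "set_integrable M (star D) (star_fun S g)"
proof -
  have gb: "g \<in> bcont S" using g by (simp add: comeas_span_def)
  then obtain K where K: "\<And>x. x \<in> topspace S \<Longrightarrow> \<bar>g x\<bar> \<le> K" by (auto simp: bcont_def bounded_iff)
  have gK: "g x \<in> {-K..K}" if "x \<in> topspace S" for x using K[OF that] by auto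
  have "star_fun S g s \<in> {-K..K}" if "ultra s" for s
    by (rule star_fun_in_closed[OF gb that ultra_topspace[OF that] _ gK]) auto
  then have "AE s in M. norm (star_fun S g s) \<le> K"
    by (intro AE_I2) (auto simp: space_M abs_le_iff minus_le_iff)
  then have "integrable M (star_fun S g)"
    using star_fun_measurable[OF g] by (rule integrable_const_bound)
  then show ?thesis
    unfolding set_integrable_def using star_measurable[OF D] by (rule integrable_mult_indicator[rotated])
qed

theorem content_integral_eq:
  assumes g: "g \<in> comeas_span S \<BB>" and D: "D \<in> \<BB>"
  shows "content_integral S \<BB> \<mu> D g = (LINT s:star D|M. star_fun S g s)"
proof -
  let ?F = "{f. reg_simple S \<BB> f \<and> (\<forall>x\<in>D. f x \<le> g x)}"
  let ?I = "LINT s:star D|M. star_fun S g s"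
  have gb: "g \<in> bcont S" using g by (simp add: comeas_span_def)
  have upper: "simple_integral S \<BB> \<mu> D f \<le> ?I" if f: "f \<in> ?F" for f
  proof -
    obtain \<P> r where \<P>: "simple_repr S \<BB> f \<P> r" using f by (auto simp: reg_simple_def)
    then have part: "reg_partition S \<BB> \<P>" by (simp add: simple_repr_def)
    have "step \<P> r s \<le> star_fun S g s" if "s \<in> star D" for s
    proof -
      have s: "ultra s" "D \<in> s" using that by (auto simp: star_set_def)
      obtain P where P: "P \<in> \<P>" "P \<in> s" using ultra_partition[OF s(1) part] by blast
      \<comment> \<open>The inequality is available only on \<open>P \<inter> D\<close>, but this
        set belongs to \<open>s\<close> together with \<open>P\<close> and \<open>D\<close>, so the
        bound transfers to \<open>s\<close>.\<close>
      have "r P \<le> g x" if "x \<in> P \<inter> D" for x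
        using that f \<P> P(1) unfolding simple_repr_def by fastforce
      then have "star_fun S g s \<in> {r P..}"
        by (intro star_fun_in_closed[OF gb s(1) ultra_Int[OF s(1) P(2) s(2)]]) auto
      then show ?thesis using step_eq[OF part s(1) P] by simp
    qed
    then have "(LINT s:star D|M. step \<P> r s) \<le> ?I"
      using integrable_step[OF part D] set_integrable_star_fun[OF g D] by (intro set_integral_mono)
    then show ?thesis by (simp add: simple_integral_eq[OF \<P> D])
  qed
  have lower: "\<exists>f\<in>?F. ?I - \<epsilon> \<le> simple_integral S \<BB> \<mu> D f" if \<epsilon>: "0 < \<epsilon>" for \<epsilon>
  proof -
    obtain \<P> r where \<P>: "reg_partition S \<BB> \<P>" "\<And>P x. P \<in> \<P> \<Longrightarrow> x \<in> P \<Longrightarrow> r P \<le> g x"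
        "\<And>s. ultra s \<Longrightarrow> \<bar>star_fun S g s - step \<P> r s\<bar> \<le> \<epsilon>"
      using star_fun_step_approx[OF g \<epsilon>] by metis
    \<comment> \<open>Off the cells \<open>f\<close> is set equal to \<open>g\<close>, so that
      \<open>f \<le> g\<close> holds at every point.\<close>
    define f where "f x = (if x \<in> \<Union>\<P> then r (THE P. P \<in> \<P> \<and> x \<in> P) else g x)" for x
    have f: "f x = r P" if "P \<in> \<P>" "x \<in> P" for x P
    proof -
      have "(THE Q. Q \<in> \<P> \<and> x \<in> Q) = P"
        using that partition_disjoint[OF \<P>(1)] by (intro the_equality) blast+
      then show ?thesis using that by (auto simp: f_def)
    qed
    then have repr: "simple_repr S \<BB> f \<P> r" using \<P>(1) by (simp add: simple_repr_def)
    have "f x \<le> g x" for x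
    proof (cases "x \<in> \<Union>\<P>")
      case True then show ?thesis using f \<P>(2) by auto
    qed (simp add: f_def)
    then have "f \<in> ?F" using repr by (auto simp: reg_simple_def)
    moreover have "?I - \<epsilon> \<le> simple_integral S \<BB> \<mu> D f"
    proof -
      have st: "set_integrable M (star D) (step \<P> r)" using \<P>(1) D by (rule integrable_step)
      have c: "set_integrable M (star D) (\<lambda>s. \<epsilon>)"
        unfolding set_integrable_def using star_measurable[OF D] by (intro integrable_mult_indicator) auto
      have "?I \<le> (LINT s:star D|M. step \<P> r s + \<epsilon>)"
      proof (rule set_integral_mono[OF set_integrable_star_fun[OF g D] set_integral_add(1)[OF st c]])
        fix s assume "s \<in> star D"
        then show "star_fun S g s \<le> step \<P> r s + \<epsilon>" using \<P>(3)[of s] by (auto simp: star_set_def)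
      qed
      also have "\<dots> = simple_integral S \<BB> \<mu> D f + (LINT s:star D|M. \<epsilon>)"
        by (simp add: set_integral_add(2)[OF st c] simple_integral_eq[OF repr D])
      also have "(LINT s:star D|M. \<epsilon>) = measure M (star D) * \<epsilon>"
        using star_measurable[OF D] sets.sets_into_space[OF star_measurable[OF D]]
        by (simp add: set_lebesgue_integral_def Int_absorb2)
      \<comment> \<open>Total mass one bounds the error by \<open>\<epsilon>\<close>, whatever
        \<open>D\<close> is.\<close>
      also have "\<dots> \<le> 1 * \<epsilon>" using \<epsilon> by (intro mult_right_mono) auto
      finally show ?thesis by simp
    qed
    ultimately show ?thesis by blast
  qed
  \<comment> \<open>The real-valued supremum is meaningful only for a nonempty family bounded
    above.\<close>
  have ne: "?F \<noteq> {}" using lower[of 1] by auto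
  have bdd: "bdd_above (simple_integral S \<BB> \<mu> D ` ?F)" using upper by (rule bdd_aboveI2)
  show ?thesis unfolding content_integral_def
  proof (rule antisym)
    show "(SUP f\<in>?F. simple_integral S \<BB> \<mu> D f) \<le> ?I" using ne upper by (rule cSUP_least)
    show "?I \<le> (SUP f\<in>?F. simple_integral S \<BB> \<mu> D f)"
    proof (rule field_le_epsilon)
      fix \<epsilon> :: real assume "0 < \<epsilon>"
      then obtain f where f: "f \<in> ?F" "?I - \<epsilon> \<le> simple_integral S \<BB> \<mu> D f" using lower by blast
      then show "?I \<le> (SUP f\<in>?F. simple_integral S \<BB> \<mu> D f) + \<epsilon>"
        using cSUP_upper[OF f(1) bdd] by linarith
    qed
  qed
qed

end

text \<open>Uniqueness takes two forms: among regular measures on all Borel sets, and among all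
  Borel extensions on the sigma-algebra generated by the clopen sets. Integrability accompanies the
  formula because the integral of a non-integrable function is zero by convention.\<close>

theorem theorem8p4:
  fixes S :: "'a topology" and \<BB> :: "'a set set" and \<mu> :: "'a set \<Rightarrow> real"
  assumes "locally_compact_space S" and "Hausdorff_space S"
    and "reg_subalgebra S \<BB>" and "generative S \<BB>"
    and "reg_content S \<BB> \<mu>"
  shows "(\<exists>!M. borel_prob (stone_space S \<BB>) M \<and> regular_borel (stone_space S \<BB>) M \<and>
               extends_charge (stone_space S \<BB>) (star_charge S \<BB> \<mu>) M) \<and>
         (\<forall>M N. borel_prob (stone_space S \<BB>) M \<and>
                 extends_charge (stone_space S \<BB>) (star_charge S \<BB> \<mu>) M \<and>
                 borel_prob (stone_space S \<BB>) N \<and>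
                 extends_charge (stone_space S \<BB>) (star_charge S \<BB> \<mu>) N \<longrightarrow>
            (\<forall>A \<in> sigma_sets (topspace (stone_space S \<BB>)) (Clp (stone_space S \<BB>)).
               emeasure M A = emeasure N A)) \<and>
         (\<forall>M. borel_prob (stone_space S \<BB>) M \<and>
               extends_charge (stone_space S \<BB>) (star_charge S \<BB> \<mu>) M \<longrightarrow>
            (\<forall>g \<in> comeas_span S \<BB>. \<forall>D \<in> \<BB>.
               set_integrable M (star_set S \<BB> D) (star_fun S g) \<and>
               content_integral S \<BB> \<mu> D g = (LINT s:star_set S \<BB> D|M. star_fun S g s)))"
proof -
  interpret reg_algebra S \<BB> using assms(3) by unfold_locales
  \<comment> \<open>Local compactness enters through complete regularity, which makes
    \<open>sc_emb S\<close> an embedding.\<close>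
  have cr: "completely_regular_space S"
    using assms(1,2) by (intro locally_compact_regular_imp_completely_regular_space) auto
  have integrals: "generative_charge_measure S \<BB> \<mu> M"
    if "borel_prob stone M" "extends_charge stone (star_charge S \<BB> \<mu>) M" for M
    using that cr assms(2,4) by unfold_locales
  show ?thesis
    using clopen_charge.ex1_regular_extension[OF clopen_charge_stone[OF assms(5)]]
      charge_extensions_agree[where Y = stone and \<nu> = "star_charge S \<BB> \<mu>"]
      generative_charge_measure.set_integrable_star_fun[OF integrals]
      generative_charge_measure.content_integral_eq[OF integrals]
    by blast
qed

end
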